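(* For any transcendental real number $\zeta$ we have \[\frac{(\overline{w}(\zeta)+1)^2}{4\overline{w}(\zeta)}\le \overline{\lambda}(\zeta)\le \overline{w}(\zeta)+2,\qquad \frac{(\underline{w}(\zeta)+1)^2}{4\underline{w}(\zeta)}\le \underline{\lambda}(\zeta)\le \underline{w}(\zeta)+2,\] and moreover $\sigma(\zeta)=-\frac{1}{\tau(\zeta)}$.
   Context: For an integer polynomial $P$, $H(P)$ is the maximum modulus of its coefficients. $w_n(\zeta)$ is the supremum of $w$ such that $0<|P(\zeta)|\le H(P)^{-w}$ has infinitely many solutions $P\in\mathbb{Z}[T]$ of degree at most $n$. $\lambda_n(\zeta)$ is the supremum of $\lambda$ such that $1\le |x|\le X$, $\max_{1\le i\le n}|\zeta^i x-y_i|\le X^{-\lambda}$ has a solution $(x,y_1,\dots,y_n)\in\mathbb{Z}^{n+1}$ for arbitrarily large $X$. Define $\overline{w}(\zeta)=\limsup_{n\to\infty}w_n(\zeta)/n$, $\underline{w}(\zeta)=\liminf_{n\to\infty}w_n(\zeta)/n$, $\overline{\lambda}(\zeta)=\limsup_{n\to\infty}n\lambda_n(\zeta)$, $\underline{\lambda}(\zeta)=\liminf_{n\to\infty}n\lambda_n(\zeta)$, $\tau(\zeta)=\limsup_{n\to\infty}\frac{\log w_n(\zeta)}{\log n}$ and $\sigma(\zeta)=\limsup_{n\to\infty}\frac{\log\lambda_n(\zeta)}{\log n}$. Conventions: $1/\infty=0$, $1/0=\infty$, with values in the extended reals.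
   Formalization: The identity σ(ζ) = −1/τ(ζ) is stated only when λ_1(ζ) is finite (ζ not a Liouville number), because for Liouville numbers σ = ∞ while −1/τ = 0; the four inequalities are stated for every transcendental real ζ. *)

theory Defs
  imports "HOL-Analysis.Analysis" "HOL-Computational_Algebra.Polynomial"
begin

definition poly_height :: "int poly \<Rightarrow> int" where
  "poly_height P = (MAX i\<in>{..degree P}. \<bar>coeff P i\<bar>)"

definition exp_w :: "nat \<Rightarrow> real \<Rightarrow> ereal" where
  "exp_w n \<zeta> = Sup (ereal ` {w::real. infinite {P :: int poly. degree P \<le> n \<and>
      0 < \<bar>poly (map_poly real_of_int P) \<zeta>\<bar> \<and>
      \<bar>poly (map_poly real_of_int P) \<zeta>\<bar> \<le> real_of_int (poly_height P) powr (- w)}})"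

text \<open>Only the values of \<open>y\<close> on \<open>{1..n}\<close> matter; the definition is meant for \<open>n \<ge> 1\<close>.\<close>

definition exp_lambda :: "nat \<Rightarrow> real \<Rightarrow> ereal" where
  "exp_lambda n \<zeta> = Sup (ereal ` {l::real. \<exists>\<^sub>F X::real in at_top.
      \<exists>(x::int) (y::nat \<Rightarrow> int). 1 \<le> \<bar>x\<bar> \<and> real_of_int \<bar>x\<bar> \<le> X \<and>
        (MAX i\<in>{1..n}. \<bar>\<zeta> ^ i * real_of_int x - real_of_int (y i)\<bar>) \<le> X powr (- l)})"

definition w_upper :: "real \<Rightarrow> ereal" where
  "w_upper \<zeta> = limsup (\<lambda>n. exp_w n \<zeta> / ereal (real n))"

definition w_lower :: "real \<Rightarrow> ereal" where
  "w_lower \<zeta> = liminf (\<lambda>n. exp_w n \<zeta> / ereal (real n))"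

definition lambda_upper :: "real \<Rightarrow> ereal" where
  "lambda_upper \<zeta> = limsup (\<lambda>n. ereal (real n) * exp_lambda n \<zeta>)"

definition lambda_lower :: "real \<Rightarrow> ereal" where
  "lambda_lower \<zeta> = liminf (\<lambda>n. ereal (real n) * exp_lambda n \<zeta>)"

definition ln_ereal :: "ereal \<Rightarrow> ereal" where
  "ln_ereal x = (if x = \<infinity> then \<infinity> else if x \<le> 0 then - \<infinity> else ereal (ln (real_of_ereal x)))"

definition exp_tau :: "real \<Rightarrow> ereal" where
  "exp_tau \<zeta> = limsup (\<lambda>n. ln_ereal (exp_w n \<zeta>) / ereal (ln (real n)))"

definition exp_sigma :: "real \<Rightarrow> ereal" where
  "exp_sigma \<zeta> = limsup (\<lambda>n. ln_ereal (exp_lambda n \<zeta>) / ereal (ln (real n)))"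

text \<open>The expression \<open>(w + 1)\<^sup>2 / (4 w) = (w + 2 + 1 / w) / 4\<close> takes the value \<open>\<infinity>\<close> at
  \<open>w = \<infinity>\<close>; the case distinction is needed because \<open>\<infinity> / \<infinity> = 0\<close> in type \<open>ereal\<close>.\<close>

definition going_up_bound :: "ereal \<Rightarrow> ereal" where
  "going_up_bound w = (if w = \<infinity> then \<infinity> else (w + 1)\<^sup>2 / (4 * w))"

text \<open>Liouville numbers are exactly the irrational \<open>\<zeta>\<close> with \<open>\<lambda>\<^sub>1(\<zeta>) = \<infinity>\<close>. For them every
  \<open>\<lambda>\<^sub>n(\<zeta>)\<close> is infinite, hence so is \<open>\<sigma>(\<zeta>)\<close>, as shown next. Since \<open>-1/\<tau>\<close> cannot be \<open>\<infinity>\<close>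
  for \<open>\<tau> \<ge> 1\<close>, the identity \<open>\<sigma> = -1/\<tau>\<close> can only be claimed when \<open>\<lambda>\<^sub>1(\<zeta>)\<close> is finite.\<close>

lemma frequently_at_top_real:
  "(\<exists>\<^sub>F X in at_top. Q X) \<longleftrightarrow> (\<forall>B::real. \<exists>X>B. Q X)"
  by (simp add: frequently_def eventually_at_top_dense)

lemma abs_power_diff_le:
  fixes u v M :: real
  assumes "\<bar>u\<bar> \<le> M" "\<bar>v\<bar> \<le> M" "1 \<le> M"
  shows "\<bar>u ^ i - v ^ i\<bar> \<le> real i * M ^ i * \<bar>u - v\<bar>"
proof (induction i)
  case 0
  show ?case by simp
next
  case (Suc i)
  have "u ^ Suc i - v ^ Suc i = u * (u ^ i - v ^ i) + v ^ i * (u - v)"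
    by (simp add: algebra_simps)
  hence "\<bar>u ^ Suc i - v ^ Suc i\<bar> \<le> \<bar>u\<bar> * \<bar>u ^ i - v ^ i\<bar> + \<bar>v\<bar> ^ i * \<bar>u - v\<bar>"
    by (metis abs_triangle_ineq abs_mult power_abs)
  also have "\<dots> \<le> M * (real i * M ^ i * \<bar>u - v\<bar>) + M ^ Suc i * \<bar>u - v\<bar>"
  proof (intro add_mono mult_mono)
    show "\<bar>v\<bar> ^ i \<le> M ^ Suc i"
      using assms by (intro order_trans[OF power_mono power_increasing]) auto
  qed (use assms Suc.IH in auto)
  also have "\<dots> = real (Suc i) * M ^ Suc i * \<bar>u - v\<bar>"
    by (simp add: algebra_simps)
  finally show ?case .
qed

lemma exp_lambda_eq_infinity:
  assumes "exp_lambda 1 \<zeta> = \<infinity>" and n: "n \<ge> 1"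
  shows "exp_lambda n \<zeta> = \<infinity>"
proof -
  define a where "a = \<bar>\<zeta>\<bar> + 1"
  have a: "a \<ge> 1" by (simp add: a_def)
  have "ereal L \<le> exp_lambda n \<zeta>" for L
  proof -
    define l0 where "l0 = 2 * real n + real n * \<bar>L\<bar> + 1"
    have "ereal l0 < exp_lambda 1 \<zeta>" using assms by simp
    then obtain l where l: "l0 < l" and fr: "\<exists>\<^sub>F X::real in at_top.
      \<exists>(x::int) (y::nat \<Rightarrow> int). 1 \<le> \<bar>x\<bar> \<and> real_of_int \<bar>x\<bar> \<le> X \<and>
        (MAX i\<in>{1..1}. \<bar>\<zeta> ^ i * real_of_int x - real_of_int (y i)\<bar>) \<le> X powr (- l)"
      unfolding exp_lambda_def less_Sup_iff by auto
    have "\<exists>\<^sub>F X::real in at_top. \<exists>(x::int) (y::nat \<Rightarrow> int). 1 \<le> \<bar>x\<bar> \<and> real_of_int \<bar>x\<bar> \<le> X \<and>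
        (MAX i\<in>{1..n}. \<bar>\<zeta> ^ i * real_of_int x - real_of_int (y i)\<bar>) \<le> X powr (- L)"
      unfolding frequently_at_top_real
    proof
      fix B :: real
      define B' where "B' = max (max B 1) (real n * a ^ n)"
      from fr[unfolded frequently_at_top_real, rule_format, of B'] obtain X x and y :: "nat \<Rightarrow> int"
        where X: "X > B'" and x: "1 \<le> \<bar>x\<bar>" "real_of_int \<bar>x\<bar> \<le> X"
          and y: "\<bar>\<zeta> * real_of_int x - real_of_int (y 1)\<bar> \<le> X powr (- l)"
        by auto
      have X1: "X > 1" "X > B" "X > real n * a ^ n" using X by (auto simp: B'_def)
      define p where "p = real_of_int (y 1)"
      define q where "q = real_of_int x"
      have q: "\<bar>q\<bar> \<le> X" "1 \<le> \<bar>q\<bar>" using x by (auto simp: q_def)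
      have l0: "l0 \<ge> 0" by (simp add: l0_def)
      have d: "\<bar>\<zeta> * q - p\<bar> \<le> X powr (- l0)"
        using order_trans[OF y powr_mono[of "- l" "- l0" X]] l X1 by (simp add: p_def q_def)
      have "X powr (- l0) \<le> 1" using l0 X1 powr_mono[of "- l0" 0 X] by simp
      hence d1: "\<bar>\<zeta> * q - p\<bar> \<le> 1" using d by simp
      have zq: "\<bar>\<zeta> * q\<bar> \<le> \<bar>\<zeta>\<bar> * X"
        unfolding abs_mult using q by (intro mult_left_mono) auto
      have M: "\<bar>\<zeta> * q\<bar> \<le> a * X" "\<bar>p\<bar> \<le> a * X" "1 \<le> a * X"
        using zq d1 X1 mult_mono[of 1 a 1 X] a by (auto simp: a_def algebra_simps)
      have main: "\<bar>\<zeta> ^ i * q ^ n - p ^ i * q ^ (n - i)\<bar> \<le> (X ^ n) powr (- L)"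
        if i: "i \<in> {1..n}" for i
      proof -
        have "\<zeta> ^ i * q ^ n - p ^ i * q ^ (n - i) = q ^ (n - i) * ((\<zeta> * q) ^ i - p ^ i)"
        proof -
          have "q ^ n = q ^ i * q ^ (n - i)" using i by (simp flip: power_add)
          thus ?thesis by (simp add: power_mult_distrib algebra_simps)
        qed
        hence "\<bar>\<zeta> ^ i * q ^ n - p ^ i * q ^ (n - i)\<bar> = \<bar>q\<bar> ^ (n - i) * \<bar>(\<zeta> * q) ^ i - p ^ i\<bar>"
          by (simp add: abs_mult power_abs)
        also have "\<dots> \<le> X ^ n * (real n * (a * X) ^ n * X powr (- l0))"
        proof (rule mult_mono)
          show "\<bar>q\<bar> ^ (n - i) \<le> X ^ n"
            using q X1 by (intro order_trans[OF power_mono power_increasing]) auto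
          have "\<bar>(\<zeta> * q) ^ i - p ^ i\<bar> \<le> real i * (a * X) ^ i * \<bar>\<zeta> * q - p\<bar>"
            by (rule abs_power_diff_le[OF M])
          also have "\<dots> \<le> real n * (a * X) ^ n * X powr (- l0)"
            using i M(3) d X1 a by (intro mult_mono power_increasing) auto
          finally show "\<bar>(\<zeta> * q) ^ i - p ^ i\<bar> \<le> real n * (a * X) ^ n * X powr (- l0)" .
        qed (use X1 in auto)
        also have "\<dots> = (real n * a ^ n) * (X powr (2 * real n) * X powr (- l0))"
          using X1 by (simp add: power_mult_distrib powr_realpow[symmetric] powr_add[symmetric])
        also have "\<dots> \<le> X * (X powr (2 * real n) * X powr (- l0))"
          using X1 by (intro mult_right_mono) auto
        also have "\<dots> = X powr (- (real n * \<bar>L\<bar>))"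
          using X1 powr_add[of X 1 "2 * real n + - l0"]
          by (simp add: powr_add[symmetric] l0_def)
        also have "\<dots> \<le> X powr (- (real n * L))"
          using X1 by (intro powr_mono) (auto intro: mult_left_mono)
        also have "\<dots> = (X ^ n) powr (- L)"
          using X1 by (simp add: powr_realpow[symmetric] powr_powr)
        finally show ?thesis .
      qed
      define y' where "y' = (\<lambda>i. y 1 ^ i * x ^ (n - i))"
      have "(MAX i\<in>{1..n}. \<bar>\<zeta> ^ i * real_of_int (x ^ n) - real_of_int (y' i)\<bar>) \<le> (X ^ n) powr (- L)"
        using n main by (subst Max_le_iff) (auto simp: y'_def p_def q_def)
      moreover have "1 \<le> \<bar>x ^ n\<bar>" using x one_le_power[of "\<bar>x\<bar>" n] by (simp add: power_abs)
      moreover have "real_of_int \<bar>x ^ n\<bar> \<le> X ^ n"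
        using power_mono[OF q(1), of n] by (simp add: q_def power_abs)
      moreover have "X ^ n > B"
        using X1 n power_increasing[of 1 n X] by simp
      ultimately show "\<exists>X>B. \<exists>(x::int) (y::nat \<Rightarrow> int). 1 \<le> \<bar>x\<bar> \<and> real_of_int \<bar>x\<bar> \<le> X \<and>
        (MAX i\<in>{1..n}. \<bar>\<zeta> ^ i * real_of_int x - real_of_int (y i)\<bar>) \<le> X powr (- L)"
        by blast
    qed
    thus ?thesis unfolding exp_lambda_def by (intro Sup_upper) auto
  qed
  thus ?thesis by (metis ereal_top)
qed

lemma exp_sigma_eq_infinity:
  assumes "exp_lambda 1 \<zeta> = \<infinity>"
  shows "exp_sigma \<zeta> = \<infinity>"
proof -
  have "\<forall>\<^sub>F n in sequentially. ln_ereal (exp_lambda n \<zeta>) / ereal (ln (real n)) = \<infinity>"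
    using eventually_ge_at_top[of 2]
    by eventually_elim (simp add: exp_lambda_eq_infinity[OF assms] ln_ereal_def)
  hence "exp_sigma \<zeta> = limsup (\<lambda>n. \<infinity>)"
    unfolding exp_sigma_def by (rule Limsup_eq)
  thus ?thesis by (simp add: Limsup_const)
qed

end

theory Submission
  imports Defs "HOL-Computational_Algebra.Polynomial_Factorial" "HOL-Real_Asymp.Real_Asymp"
begin

text \<open>
  Lower bounds for \<open>\<lambda>\<^sub>N\<close>: let \<open>P\<close> have degree at most \<open>k \<le> N\<close>, height \<open>H\<close> and \<open>\<bar>P(\<zeta>)\<bar> \<le> H\<^bsup>-w\<^esup>\<close>.
  Integer sequences \<open>v\<^sub>0, \<dots>, v\<^sub>N\<close> satisfying the linear recurrence with characteristic polynomial
  \<open>P\<close> form a lattice of rank \<open>k\<close> and covolume about \<open>H\<^bsup>N-k+1\<^esup>\<close>, and the recurrence propagates closeness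
  to a geometric progression. The pigeonhole principle in this lattice gives
  \<open>\<lambda>\<^sub>N \<ge> (w + k - N) / ((k - 1) w + N)\<close> for \<open>N - k < w < w\<^sub>k\<close>. To keep the pivot coefficient comparable
  with \<open>H\<close>, the variable is first shifted by an integer \<open>c\<close> with \<open>\<bar>P(c)\<bar>\<close> comparable with \<open>H\<close> and the
  recurrence is run backwards.

  Lower bounds for \<open>w\<^sub>n\<close>: let \<open>\<lambda>\<^sub>N > 1/n\<close> and \<open>m = N - n + 1 \<ge> n\<close>. A good approximation \<open>v\<close> with
  \<open>v\<^sub>0 = X\<close>, viewed as a linear functional \<open>T\<^sup>i \<mapsto> v\<^sub>i\<close>, kills all multiples of degree at most \<open>N\<close> of the
  Dirichlet polynomials of degrees \<open>n\<close> and \<open>m\<close> with value below \<open>1/X\<close> at \<open>\<zeta>\<close>. By Bezout it kills their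
  greatest common divisor \<open>G\<close>, whose height is \<open>O(X\<^bsup>1/m\<^esup>)\<close> and whose value at \<open>\<zeta>\<close> is therefore tiny;
  hence \<open>w\<^sub>n \<ge> N - n\<close>.

  The theorem follows by taking \<open>N\<close> about \<open>k (w + 1) / 2\<close> resp. \<open>n\<close> about \<open>N / L\<close> where \<open>L < N \<lambda>\<^sub>N\<close>, and for
  the logarithmic exponents \<open>N\<close> about \<open>k\<^sup>t / 2\<close> resp. \<open>n\<close> about \<open>N\<^sup>s\<close>.
\<close>

subsection \<open>Heights of integer polynomials\<close>

lemma abs_coeff_le_poly_height: "\<bar>coeff P i\<bar> \<le> poly_height P"
proof (cases "i \<le> degree P")
  case True
  then show ?thesis unfolding poly_height_def by (intro Max_ge) auto
next
  case False
  then have "\<bar>coeff P i\<bar> \<le> \<bar>coeff P 0\<bar>" by (simp add: coeff_eq_0)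
  also have "\<dots> \<le> poly_height P" unfolding poly_height_def by (intro Max_ge) auto
  finally show ?thesis .
qed

lemma poly_height_le_iff: "poly_height P \<le> B \<longleftrightarrow> (\<forall>i. \<bar>coeff P i\<bar> \<le> B)"
proof
  assume "poly_height P \<le> B"
  then show "\<forall>i. \<bar>coeff P i\<bar> \<le> B" using abs_coeff_le_poly_height order_trans by blast
next
  assume "\<forall>i. \<bar>coeff P i\<bar> \<le> B"
  then show "poly_height P \<le> B" unfolding poly_height_def by (subst Max_le_iff) auto
qed

lemma poly_height_ge_1:
  assumes "P \<noteq> 0"
  shows "1 \<le> poly_height P"
  using abs_coeff_le_poly_height[of P "degree P"] assms
  by (smt (verit, best) leading_coeff_0_iff)

lemma poly_height_nonneg: "0 \<le> poly_height P"
  using abs_coeff_le_poly_height[of P 0] by linarith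

text \<open>Used contrapositively: an infinite family of polynomials of bounded degree contains
  members of arbitrarily large height.\<close>

lemma finite_bounded_height: "finite {P :: int poly. degree P \<le> n \<and> poly_height P \<le> B}"
proof (rule finite_subset)
  show "{P :: int poly. degree P \<le> n \<and> poly_height P \<le> B}
    \<subseteq> Poly ` {xs. set xs \<subseteq> {-B..B} \<and> length xs \<le> Suc n}"
  proof
    fix P :: "int poly"
    assume "P \<in> {P. degree P \<le> n \<and> poly_height P \<le> B}"
    then have P: "degree P \<le> n" "\<And>i. \<bar>coeff P i\<bar> \<le> B"
      by (auto simp: poly_height_le_iff)
    have "length (coeffs P) \<le> Suc n" using P(1) by (auto simp: length_coeffs degree_eq_length_coeffs)
    moreover have "set (coeffs P) \<subseteq> {-B..B}"
      using P(2) by (auto simp: coeffs_def abs_le_iff minus_le_iff split: if_splits)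
    ultimately show "P \<in> Poly ` {xs. set xs \<subseteq> {-B..B} \<and> length xs \<le> Suc n}"
      by (intro image_eqI[of _ _ "coeffs P"]) auto
  qed
  show "finite (Poly ` {xs. set xs \<subseteq> {-B..B} \<and> length xs \<le> Suc n})"
    by (intro finite_imageI finite_lists_length_le) auto
qed

lemma poly_map_real_eq_sum:
  assumes "degree P \<le> n"
  shows "poly (map_poly real_of_int P) x = (\<Sum>i\<le>n. real_of_int (coeff P i) * x ^ i)"
proof -
  have "poly (map_poly real_of_int P) x = (\<Sum>i\<le>degree P. real_of_int (coeff P i) * x ^ i)"
    by (simp add: poly_altdef degree_map_poly coeff_map_poly)
  also have "\<dots> = (\<Sum>i\<le>n. real_of_int (coeff P i) * x ^ i)"
    using assms by (intro sum.mono_neutral_left) (auto simp: coeff_eq_0)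
  finally show ?thesis .
qed

lemma poly_eq_sum:
  fixes P :: "int poly"
  assumes "degree P \<le> n"
  shows "poly P c = (\<Sum>i\<le>n. coeff P i * c ^ i)"
  unfolding poly_altdef using assms by (intro sum.mono_neutral_left) (auto simp: coeff_eq_0)

lemma transcendental_poly_nonzero:
  assumes "\<not> algebraic \<zeta>" "P \<noteq> 0"
  shows "poly (map_poly real_of_int P) \<zeta> \<noteq> 0"
proof
  assume "poly (map_poly real_of_int P) \<zeta> = 0"
  moreover have "map_poly real_of_int P \<noteq> 0" using assms(2) by (subst map_poly_eq_0_iff) auto
  moreover have "coeff (map_poly real_of_int P) i \<in> \<int>" for i by (simp add: coeff_map_poly)
  ultimately show False using assms(1) algebraicI by blast
qed

lemma transcendental_irrational:
  assumes "\<not> algebraic (\<zeta>::real)"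
  shows "\<zeta> \<noteq> real_of_int a / real_of_int b"
proof
  assume "\<zeta> = real_of_int a / real_of_int b"
  then show False using assms by (metis rat_imp_algebraic Rats_of_int Rats_divide)
qed

section \<open>Heights compared with values at integers\<close>

text \<open>Newton interpolation: each step divides by \<open>b - a\<close> for distinct integers \<open>a\<close>, \<open>b\<close>, which
  does not increase absolute values.\<close>

lemma coeff_bound_from_values:
  fixes A :: "int set"
  assumes "finite A"
  shows "\<exists>C\<ge>0. \<forall>(P :: int poly) M. (P = 0 \<or> degree P < card A) \<longrightarrow> M \<ge> 0 \<longrightarrow>
    (\<forall>a\<in>A. \<bar>poly P a\<bar> \<le> M) \<longrightarrow> (\<forall>i. \<bar>coeff P i\<bar> \<le> C * M)"
  using assms
proof (induction A rule: finite_induct)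
  case empty
  show ?case by (intro exI[of _ 0]) auto
next
  case (insert a A)
  then obtain C where C: "C \<ge> 0" and IH: "\<And>(P :: int poly) M i. (P = 0 \<or> degree P < card A) \<Longrightarrow>
    M \<ge> 0 \<Longrightarrow> (\<forall>a\<in>A. \<bar>poly P a\<bar> \<le> M) \<Longrightarrow> \<bar>coeff P i\<bar> \<le> C * M" by meson
  \<comment> \<open>The quotient by T - a has values at most 2 M on \<open>A\<close>, hence
    coefficients at most 2 C M. Multiplying back by T - a costs the factor |a| + 1, and the last
    summand 1 accounts for the constant term P(a).\<close>
  show ?case
  proof (intro exI[of _ "(\<bar>a\<bar> + 1) * (C * 2) + 1"] conjI allI impI)
    show "0 \<le> (\<bar>a\<bar> + 1) * (C * 2) + 1" using C by simp
    fix P :: "int poly" and M i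
    assume P: "P = 0 \<or> degree P < card (insert a A)" and M: "M \<ge> 0"
      and val: "\<forall>a\<in>insert a A. \<bar>poly P a\<bar> \<le> M"
    define Q where "Q = synthetic_div P a"
    have PQ: "P = [:-a, 1:] * Q + [:poly P a:]" by (simp only: Q_def synthetic_div_correct')
    have degQ: "Q = 0 \<or> degree Q < card A"
    proof (cases "degree P = 0")
      case True
      then show ?thesis by (simp add: Q_def synthetic_div_eq_0_iff)
    next
      case False
      then have "degree P < Suc (card A)" using P insert.hyps by auto
      then show ?thesis using False by (auto simp: Q_def degree_synthetic_div)
    qed
    have valQ: "\<bar>poly Q b\<bar> \<le> 2 * M" if "b \<in> A" for b
    proof -
      have "b \<noteq> a" using that insert.hyps by auto
      have "poly P b = (b - a) * poly Q b + poly P a"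
        by (subst PQ) (simp add: algebra_simps)
      then have "\<bar>b - a\<bar> * \<bar>poly Q b\<bar> \<le> \<bar>poly P b\<bar> + \<bar>poly P a\<bar>"
        by (simp flip: abs_mult)
      moreover have "1 * \<bar>poly Q b\<bar> \<le> \<bar>b - a\<bar> * \<bar>poly Q b\<bar>"
        using \<open>b \<noteq> a\<close> by (intro mult_right_mono) auto
      moreover have "\<bar>poly P b\<bar> \<le> M" "\<bar>poly P a\<bar> \<le> M" using val that by auto
      ultimately show ?thesis by linarith
    qed
    have cQ: "\<bar>coeff Q j\<bar> \<le> C * (2 * M)" for j
      using IH[of Q "2 * M"] degQ M valQ by auto
    have P': "P = smult (-a) Q + pCons 0 Q + [:poly P a:]"
      by (subst PQ) simp
    have "coeff P i = - a * coeff Q i + coeff (pCons 0 Q) i + coeff [:poly P a:] i"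
      using arg_cong[OF P', of "\<lambda>p. coeff p i"] by (simp only: coeff_add coeff_smult)
    then have "\<bar>coeff P i\<bar> \<le> \<bar>- a * coeff Q i\<bar> + \<bar>coeff (pCons 0 Q) i\<bar> + \<bar>coeff [:poly P a:] i\<bar>"
      by linarith
    then have "\<bar>coeff P i\<bar> \<le> \<bar>a\<bar> * \<bar>coeff Q i\<bar> + \<bar>coeff (pCons 0 Q) i\<bar> + \<bar>coeff [:poly P a:] i\<bar>"
      by (simp only: abs_mult abs_minus_cancel)
    also have "\<dots> \<le> \<bar>a\<bar> * (C * (2 * M)) + C * (2 * M) + M"
    proof (intro add_mono mult_left_mono cQ)
      show "\<bar>coeff (pCons 0 Q) i\<bar> \<le> C * (2 * M)" using cQ C M by (cases i) auto
      show "\<bar>coeff [:poly P a:] i\<bar> \<le> M" using val M by (cases i) auto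
    qed auto
    also have "\<dots> = ((\<bar>a\<bar> + 1) * (C * 2) + 1) * M" by (simp add: algebra_simps)
    finally show "\<bar>coeff P i\<bar> \<le> ((\<bar>a\<bar> + 1) * (C * 2) + 1) * M" .
  qed
qed

text \<open>Interpolation at the k + 1 integers 0, ..., k bounds the height by the largest value
  there. The integer \<open>c\<close> found here is the shift that later makes the pivot coefficient
  comparable with the height.\<close>

lemma poly_height_le_value:
  "\<exists>C\<ge>1. \<forall>P :: int poly. degree P \<le> k \<longrightarrow>
    (\<exists>c\<in>{0..int k}. poly_height P \<le> C * \<bar>poly P c\<bar>)"
proof -
  obtain C where C: "C \<ge> 0" and *: "\<And>(P :: int poly) M i. (P = 0 \<or> degree P < card {0..int k}) \<Longrightarrow>
    M \<ge> 0 \<Longrightarrow> (\<forall>a\<in>{0..int k}. \<bar>poly P a\<bar> \<le> M) \<Longrightarrow> \<bar>coeff P i\<bar> \<le> C * M"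
    using coeff_bound_from_values[of "{0..int k}"] by fastforce
  show ?thesis
  proof (intro exI[of _ "C + 1"] conjI allI impI)
    show "1 \<le> C + 1" using C by simp
    fix P :: "int poly"
    assume deg: "degree P \<le> k"
    define M where "M = (MAX c\<in>{0..int k}. \<bar>poly P c\<bar>)"
    have "M \<in> (\<lambda>c. \<bar>poly P c\<bar>) ` {0..int k}" unfolding M_def by (intro Max_in) auto
    then obtain c where c: "c \<in> {0..int k}" "M = \<bar>poly P c\<bar>" by auto
    have M: "\<forall>a\<in>{0..int k}. \<bar>poly P a\<bar> \<le> M" unfolding M_def by auto
    have "\<bar>coeff P i\<bar> \<le> C * M" for i
      by (rule *) (use deg c M in auto)
    then have "poly_height P \<le> C * M" by (simp add: poly_height_le_iff)
    also have "\<dots> \<le> (C + 1) * M" using c by (intro mult_right_mono) auto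
    finally show "\<exists>c\<in>{0..int k}. poly_height P \<le> (C + 1) * \<bar>poly P c\<bar>" using c by auto
  qed
qed

text \<open>A quotient \<open>Q = P / G\<close> vanishes at few integers; at the others \<open>\<bar>G(c)\<bar> \<le> \<bar>P(c)\<bar>\<close>.\<close>

lemma poly_height_divisor:
  "\<exists>C\<ge>1. \<forall>P G :: int poly. degree P \<le> m \<longrightarrow> P \<noteq> 0 \<longrightarrow> G dvd P \<longrightarrow>
    poly_height G \<le> C * poly_height P"
proof -
  define U where "U = {0..int m}"
  \<comment> \<open>The interpolation points depend on the zeros of the cofactor, so a constant is
    chosen for every subset of \<open>U\<close>. The sum \<open>K\<close> of these finitely many
    constants serves all of them.\<close>
  have "\<exists>C. \<forall>A\<in>Pow U. C A \<ge> (0::int) \<and> (\<forall>(P :: int poly) M. (P = 0 \<or> degree P < card A) \<longrightarrow>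
    M \<ge> 0 \<longrightarrow> (\<forall>a\<in>A. \<bar>poly P a\<bar> \<le> M) \<longrightarrow> (\<forall>i. \<bar>coeff P i\<bar> \<le> C A * M))"
    by (intro bchoice ballI coeff_bound_from_values[unfolded Bex_def])
       (auto simp: U_def intro: finite_subset)
  then obtain C where C: "\<And>A. A \<subseteq> U \<Longrightarrow> C A \<ge> 0"
    and CA: "\<And>A (P :: int poly) M i. A \<subseteq> U \<Longrightarrow> (P = 0 \<or> degree P < card A) \<Longrightarrow> M \<ge> 0 \<Longrightarrow>
      (\<forall>a\<in>A. \<bar>poly P a\<bar> \<le> M) \<Longrightarrow> \<bar>coeff P i\<bar> \<le> C A * M"
    by (metis PowI)
  define K where "K = (\<Sum>A\<in>Pow U. C A)"
  have K: "C A \<le> K" if "A \<subseteq> U" for A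
    unfolding K_def using that C by (intro member_le_sum) (auto simp: U_def)
  have K0: "K \<ge> 0" unfolding K_def using C by (intro sum_nonneg) auto
  define S where "S = (\<Sum>i\<le>m. int m ^ i)"
  have S0: "S \<ge> 0" unfolding S_def by (intro sum_nonneg) auto
  show ?thesis
  proof (intro exI[of _ "K * S + 1"] conjI allI impI)
    show "1 \<le> K * S + 1" using K0 S0 by simp
    fix P G :: "int poly"
    assume deg: "degree P \<le> m" and P0: "P \<noteq> 0" and "G dvd P"
    then obtain Q where Q: "P = G * Q" by (elim dvdE)
    define A where "A = {a \<in> U. poly Q a \<noteq> 0}"
    have AU: "A \<subseteq> U" by (auto simp: A_def)
    then have finA: "finite A" by (rule finite_subset) (simp add: U_def)
    have nz: "G \<noteq> 0" "Q \<noteq> 0" using P0 Q by auto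
    have degs: "degree G + degree Q \<le> m" using deg nz Q by (simp add: degree_mult_eq)
    \<comment> \<open>At most deg Q of the m + 1 points are lost, and deg G + deg Q is at most m, so
      more than deg G points remain to interpolate G.\<close>
    have "card (U - A) \<le> card {a. poly Q a = 0}"
      using nz by (intro card_mono poly_roots_finite) (auto simp: A_def)
    also have "\<dots> \<le> degree Q" using nz by (intro card_poly_roots_bound) 
    finally have "card (U - A) \<le> degree Q" .
    moreover have "card U = Suc m" by (simp add: U_def)
    moreover have "card (U - A) = card U - card A"
      using finA AU by (rule card_Diff_subset)
    moreover have "card A \<le> card U" by (intro card_mono) (auto simp: A_def U_def)
    ultimately have cardA: "degree G < card A" using degs by linarith
    have val: "\<bar>poly G a\<bar> \<le> S * poly_height P" if "a \<in> A" for a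
    proof -
      have a: "0 \<le> a" "a \<le> int m" "poly Q a \<noteq> 0" using that by (auto simp: A_def U_def)
      have "\<bar>poly G a\<bar> * 1 \<le> \<bar>poly G a\<bar> * \<bar>poly Q a\<bar>" using a by (intro mult_left_mono) auto
      also have "\<dots> = \<bar>poly P a\<bar>" by (simp add: Q abs_mult)
      also have "\<dots> = \<bar>\<Sum>i\<le>m. coeff P i * a ^ i\<bar>" using deg by (simp add: poly_eq_sum)
      also have "\<dots> \<le> (\<Sum>i\<le>m. poly_height P * int m ^ i)"
        by (intro order_trans[OF sum_abs] sum_mono)
           (use a in \<open>auto simp: abs_mult intro!: mult_mono power_mono abs_coeff_le_poly_height poly_height_nonneg\<close>)
      also have "\<dots> = S * poly_height P" by (simp add: S_def sum_distrib_left mult.commute)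
      finally show ?thesis by simp
    qed
    have "\<bar>coeff G i\<bar> \<le> C A * (S * poly_height P)" for i
      by (rule CA) (use cardA val S0 AU poly_height_nonneg in auto)
    then have "poly_height G \<le> C A * (S * poly_height P)" by (simp add: poly_height_le_iff)
    also have "\<dots> \<le> K * (S * poly_height P)"
      using K[OF AU] S0 poly_height_nonneg by (intro mult_right_mono) auto
    also have "\<dots> \<le> (K * S + 1) * poly_height P"
      using poly_height_nonneg[of P] by (simp add: algebra_simps)
    finally show "poly_height G \<le> (K * S + 1) * poly_height P" .
  qed
qed

subsection \<open>Bounding the exponents\<close>

text \<open>Strict slack below \<open>a\<close> absorbs multiplicative constants in later estimates;
  the lower cutoff \<open>b\<close> allows extra assumptions on \<open>l\<close>, such as
  positivity.\<close>

lemma ereal_le_dense: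
  assumes "\<And>l. b < l \<Longrightarrow> l < a \<Longrightarrow> ereal l \<le> y" and "b < a"
  shows "ereal a \<le> y"
proof (rule ccontr)
  assume "\<not> ereal a \<le> y"
  then have "max y (ereal b) < ereal a" using assms(2) by simp
  then obtain l where l: "max y (ereal b) < ereal l" "ereal l < ereal a"
    using ereal_dense2 by blast
  then have "ereal l \<le> y" using assms(1)[of l] by simp
  then show False using l(1) by (simp add: not_less[symmetric])
qed

text \<open>Finitely many nonzero values have a positive minimum, so solutions with arbitrarily
  small values at \<open>\<zeta>\<close> are automatically infinite in number. Thus no growth of the
  heights has to be shown.\<close>

lemma exp_w_geI:
  assumes tr: "\<not> algebraic \<zeta>"
    and small: "\<And>\<epsilon>. \<epsilon> > 0 \<Longrightarrow> \<exists>P. P \<noteq> 0 \<and> degree P \<le> n \<and> \<bar>poly (map_poly real_of_int P) \<zeta>\<bar> < \<epsilon> \<and>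
      \<bar>poly (map_poly real_of_int P) \<zeta>\<bar> \<le> real_of_int (poly_height P) powr (- w)"
  shows "ereal w \<le> exp_w n \<zeta>"
proof -
  define S where "S = {P :: int poly. degree P \<le> n \<and> 0 < \<bar>poly (map_poly real_of_int P) \<zeta>\<bar> \<and>
      \<bar>poly (map_poly real_of_int P) \<zeta>\<bar> \<le> real_of_int (poly_height P) powr (- w)}"
  define f where "f = (\<lambda>P. \<bar>poly (map_poly real_of_int P) \<zeta>\<bar>)"
  have "infinite S"
  proof
    assume fin: "finite S"
    define \<epsilon> where "\<epsilon> = Min (insert 1 (f ` S))"
    have "\<epsilon> > 0" unfolding \<epsilon>_def using fin by (subst Min_gr_iff) (auto simp: S_def f_def)
    from small[OF this] obtain P where P: "P \<noteq> 0" "degree P \<le> n" "f P < \<epsilon>"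
      "f P \<le> real_of_int (poly_height P) powr (- w)" unfolding f_def by blast
    then have "P \<in> S" using transcendental_poly_nonzero[OF tr] by (auto simp: S_def f_def)
    then have "\<epsilon> \<le> f P" unfolding \<epsilon>_def using fin by (intro Min_le) auto
    then show False using P by simp
  qed
  then show ?thesis unfolding exp_w_def S_def by (intro Sup_upper) auto
qed

text \<open>Nonzero integer polynomials have height at least 1, so the condition only weakens when
  the exponent w' supplied by the supremum is lowered to \<open>w\<close>.\<close>

lemma exp_w_greaterD:
  assumes "ereal w < exp_w n \<zeta>"
  shows "infinite {P :: int poly. degree P \<le> n \<and> P \<noteq> 0 \<and>
      \<bar>poly (map_poly real_of_int P) \<zeta>\<bar> \<le> real_of_int (poly_height P) powr (- w)}"
proof -
  from assms obtain w' where w': "w < w'" and inf: "infinite {P :: int poly. degree P \<le> n \<and>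
      0 < \<bar>poly (map_poly real_of_int P) \<zeta>\<bar> \<and>
      \<bar>poly (map_poly real_of_int P) \<zeta>\<bar> \<le> real_of_int (poly_height P) powr (- w')}"
    unfolding exp_w_def less_Sup_iff by auto
  show ?thesis
  proof (rule infinite_super[OF _ inf], safe)
    fix P :: "int poly"
    assume P: "0 < \<bar>poly (map_poly real_of_int P) \<zeta>\<bar>"
      "\<bar>poly (map_poly real_of_int P) \<zeta>\<bar> \<le> real_of_int (poly_height P) powr (- w')"
    then have "P \<noteq> 0" by auto
    then have "1 \<le> real_of_int (poly_height P)" using poly_height_ge_1 by fastforce
    then have "real_of_int (poly_height P) powr (- w') \<le> real_of_int (poly_height P) powr (- w)"
      using w' by (intro powr_mono) auto
    then show "\<bar>poly (map_poly real_of_int P) \<zeta>\<bar> \<le> real_of_int (poly_height P) powr (- w)"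
      using P by simp
  qed auto
qed

text \<open>Lets the approximations be measured by an auxiliary parameter \<open>h\<close> such as a
  height. The choice X = C h^A turns the error into X^(-B/A) up to a constant, which disappears in
  the supremum.\<close>

lemma exp_lambda_geI:
  assumes N: "N \<ge> 1" and A: "A > 0" and C: "C > 0"
    and sol: "\<And>B0. \<exists>h>B0. \<exists>(x::int) (y::nat \<Rightarrow> int). 1 \<le> \<bar>x\<bar> \<and> real_of_int \<bar>x\<bar> \<le> C * h powr A \<and>
      (\<forall>i\<in>{1..N}. \<bar>\<zeta> ^ i * real_of_int x - real_of_int (y i)\<bar> \<le> C * h powr (- B))"
  shows "ereal (B / A) \<le> exp_lambda N \<zeta>"
proof (rule ereal_le_dense)
  show "B / A - 1 < B / A" by simp
  fix l assume l: "l < B / A"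
  have "\<exists>\<^sub>F X::real in at_top. \<exists>(x::int) (y::nat \<Rightarrow> int). 1 \<le> \<bar>x\<bar> \<and> real_of_int \<bar>x\<bar> \<le> X \<and>
        (MAX i\<in>{1..N}. \<bar>\<zeta> ^ i * real_of_int x - real_of_int (y i)\<bar>) \<le> X powr (- l)"
    unfolding frequently_at_top_real
  proof
    fix B0 :: real
    \<comment> \<open>The quotient of C h^(-B) by (C h^A)^(-l) is C^(1 + l) h^(A l - B); its
      exponent is negative because l < B / A.\<close>
    have neg: "A * l - B < 0" using l A by (simp add: field_simps)
    have "((\<lambda>h. C powr (1 + l) * h powr (A * l - B)) \<longlongrightarrow> C powr (1 + l) * 0) at_top"
      by (intro tendsto_intros tendsto_neg_powr neg filterlim_ident)
    then have "\<forall>\<^sub>F h in at_top. C powr (1 + l) * h powr (A * l - B) < 1"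
      by (rule order_tendstoD) simp
    moreover have "filterlim (\<lambda>h. C * h powr A) at_top at_top"
      using A C by real_asymp
    then have "\<forall>\<^sub>F h in at_top. C * h powr A > B0" by (simp add: filterlim_at_top_dense)
    ultimately have "\<forall>\<^sub>F h in at_top. C powr (1 + l) * h powr (A * l - B) < 1 \<and> C * h powr A > B0 \<and> h > 0"
      using eventually_gt_at_top[of 0] by eventually_elim auto
    then obtain h0 where h0: "\<And>h. h > h0 \<Longrightarrow>
      C powr (1 + l) * h powr (A * l - B) < 1 \<and> C * h powr A > B0 \<and> h > 0"
      unfolding eventually_at_top_dense by blast
    from sol[of h0] obtain h x y where h: "h > h0" and x: "1 \<le> \<bar>x\<bar>" "real_of_int \<bar>x\<bar> \<le> C * h powr A"
      and y: "\<forall>i\<in>{1..N}. \<bar>\<zeta> ^ i * real_of_int x - real_of_int (y i)\<bar> \<le> C * h powr (- B)"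
      by blast
    from h0[OF h] have h': "C powr (1 + l) * h powr (A * l - B) < 1" "C * h powr A > B0" "h > 0" by auto
    have "C * h powr (- B) = (C powr (1 + l) * h powr (A * l - B)) * (C powr (- l) * h powr (- (A * l)))"
    proof -
      have "C = C powr (1 + l) * C powr (- l)" using C by (simp flip: powr_add)
      moreover have "h powr (- B) = h powr (A * l - B) * h powr (- (A * l))"
        using h' by (simp flip: powr_add)
      ultimately show ?thesis by (metis mult.assoc mult.left_commute)
    qed
    also have "\<dots> \<le> 1 * (C powr (- l) * h powr (- (A * l)))"
      using h' by (intro mult_right_mono) auto
    also have "\<dots> = (C * h powr A) powr (- l)"
      using C h' by (simp add: powr_mult powr_powr)
    finally have "C * h powr (- B) \<le> (C * h powr A) powr (- l)" .
    then have "(MAX i\<in>{1..N}. \<bar>\<zeta> ^ i * real_of_int x - real_of_int (y i)\<bar>) \<le> (C * h powr A) powr (- l)"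
      using N y by (subst Max_le_iff) force+
    then show "\<exists>X>B0. \<exists>(x::int) (y::nat \<Rightarrow> int). 1 \<le> \<bar>x\<bar> \<and> real_of_int \<bar>x\<bar> \<le> X \<and>
        (MAX i\<in>{1..N}. \<bar>\<zeta> ^ i * real_of_int x - real_of_int (y i)\<bar>) \<le> X powr (- l)"
      using h' x by blast
  qed
  then show "ereal l \<le> exp_lambda N \<zeta>" unfolding exp_lambda_def by (intro Sup_upper) auto
qed

text \<open>The definition bounds the error by a power of X, while \<open>x\<close> itself might
  stay small. Irrationality of \<open>\<zeta>\<close> keeps \<open>\<zeta>\<close> x away from the
  integers for the finitely many nonzero x of bounded size, so a small error forces \<open>x\<close>
  to be large. The bound in X then implies the one in \<open>x\<close>, and a change of sign makes
  \<open>x\<close> positive.\<close>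

lemma exp_lambda_greaterD:
  assumes tr: "\<not> algebraic \<zeta>" and N: "N \<ge> 1" and l: "0 < l" "ereal l < exp_lambda N \<zeta>"
  shows "\<exists>(x::int) (y::nat \<Rightarrow> int). B0 < real_of_int x \<and> 0 < x \<and>
    (\<forall>i\<in>{1..N}. \<bar>\<zeta> ^ i * real_of_int x - real_of_int (y i)\<bar> \<le> real_of_int x powr (- l))"
proof -
  from l(2) obtain l' where l': "l < l'" and fr: "\<exists>\<^sub>F X::real in at_top.
      \<exists>(x::int) (y::nat \<Rightarrow> int). 1 \<le> \<bar>x\<bar> \<and> real_of_int \<bar>x\<bar> \<le> X \<and>
        (MAX i\<in>{1..N}. \<bar>\<zeta> ^ i * real_of_int x - real_of_int (y i)\<bar>) \<le> X powr (- l')"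
    unfolding exp_lambda_def less_Sup_iff by auto
  define f where "f = (\<lambda>x::int. \<bar>\<zeta> * real_of_int x - real_of_int (round (\<zeta> * real_of_int x))\<bar>)"
  have fpos: "f x > 0" if "x \<noteq> 0" for x
  proof (rule ccontr)
    assume "\<not> f x > 0"
    then have "\<zeta> = real_of_int (round (\<zeta> * real_of_int x)) / real_of_int x"
      using that by (simp add: f_def field_simps)
    then show False using transcendental_irrational[OF tr] by blast
  qed
  define U where "U = {-\<lceil>B0\<rceil>..\<lceil>B0\<rceil>} - {0}"
  define \<delta> where "\<delta> = Min (insert 1 (f ` U))"
  have \<delta>: "\<delta> > 0" unfolding \<delta>_def U_def using fpos by (subst Min_gr_iff) auto
  have "((\<lambda>X. X powr (- l')) \<longlongrightarrow> 0) at_top"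
    by (intro tendsto_neg_powr filterlim_ident) (use l l' in auto)
  then have "\<forall>\<^sub>F X in at_top. X powr (- l') < \<delta>" using \<delta> by (rule order_tendstoD)
  then obtain X0 where X0: "\<And>X. X > X0 \<Longrightarrow> X powr (- l') < \<delta>"
    unfolding eventually_at_top_dense by blast
  from fr[unfolded frequently_at_top_real, rule_format, of X0] obtain X x and y :: "nat \<Rightarrow> int"
    where X: "X > X0" and x: "1 \<le> \<bar>x\<bar>" "real_of_int \<bar>x\<bar> \<le> X"
      and y: "(MAX i\<in>{1..N}. \<bar>\<zeta> ^ i * real_of_int x - real_of_int (y i)\<bar>) \<le> X powr (- l')"
    by auto
  have y': "\<bar>\<zeta> ^ i * real_of_int x - real_of_int (y i)\<bar> \<le> X powr (- l')" if "i \<in> {1..N}" for i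
    using y that by (subst (asm) Max_le_iff) auto
  have "f x \<le> \<bar>\<zeta> * real_of_int x - real_of_int (y 1)\<bar>"
    unfolding f_def by (rule round_diff_minimal)
  also have "\<dots> < \<delta>" using y'[of 1] N X0[OF X] by simp
  finally have "x \<notin> U" unfolding \<delta>_def U_def by (subst (asm) Min_gr_iff) auto
  then have "\<bar>x\<bar> > \<lceil>B0\<rceil>" using x by (auto simp: U_def)
  then have big: "B0 < real_of_int \<bar>x\<bar>" by linarith
  have "X powr (- l') \<le> real_of_int \<bar>x\<bar> powr (- l')"
    using x l l' by (intro powr_mono2') auto
  also have "\<dots> \<le> real_of_int \<bar>x\<bar> powr (- l)"
    using x l' by (intro powr_mono) auto
  finally have *: "X powr (- l') \<le> real_of_int \<bar>x\<bar> powr (- l)" .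
  have "\<bar>\<zeta> ^ i * real_of_int \<bar>x\<bar> - real_of_int (sgn x * y i)\<bar> \<le> real_of_int \<bar>x\<bar> powr (- l)"
    if "i \<in> {1..N}" for i
  proof -
    have "\<zeta> ^ i * real_of_int \<bar>x\<bar> - real_of_int (sgn x * y i) =
      real_of_int (sgn x) * (\<zeta> ^ i * real_of_int x - real_of_int (y i))"
      by (cases "x > 0") (use x in \<open>auto simp: sgn_if algebra_simps\<close>)
    moreover have "\<bar>real_of_int (sgn x)\<bar> = 1" using x by (auto simp: sgn_if)
    ultimately show ?thesis using y'[OF that] * by (simp only: abs_mult mult_1)
  qed
  then show ?thesis using big x by (intro exI[of _ "\<bar>x\<bar>"] exI[of _ "\<lambda>i. sgn x * y i"]) auto
qed

lemma exp_lambda_antimono: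
  assumes "1 \<le> m" "m \<le> n"
  shows "exp_lambda n \<zeta> \<le> exp_lambda m \<zeta>"
proof -
  have "(MAX i\<in>{1..m}. \<bar>\<zeta> ^ i * real_of_int x - real_of_int (y i)\<bar>)
      \<le> (MAX i\<in>{1..n}. \<bar>\<zeta> ^ i * real_of_int x - real_of_int (y i)\<bar>)" for x and y :: "nat \<Rightarrow> int"
    using assms by (intro Max_mono) auto
  then have *: "(MAX i\<in>{1..m}. \<bar>\<zeta> ^ i * real_of_int x - real_of_int (y i)\<bar>) \<le> r"
    if "(MAX i\<in>{1..n}. \<bar>\<zeta> ^ i * real_of_int x - real_of_int (y i)\<bar>) \<le> r"
    for x and y :: "nat \<Rightarrow> int" and r using that order_trans by blast
  show ?thesis unfolding exp_lambda_def
    by (intro Sup_subset_mono image_mono Collect_mono impI) (erule frequently_elim1, use * in blast)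
qed

subsection \<open>Dirichlet's theorem\<close>

text \<open>Simultaneous approximation with parameter D gives a denominator at most D^n and errors
  below 1/D, so the ratio of exponents is 1/n.\<close>

lemma exp_lambda_ge_inverse:
  assumes "n \<ge> 1"
  shows "ereal (1 / real n) \<le> exp_lambda n \<zeta>"
proof (rule exp_lambda_geI[where C = 1])
  fix B0 :: real
  define D where "D = nat (max 1 (\<lfloor>B0\<rfloor> + 1))"
  have D: "D \<ge> 1" "real D > B0" unfolding D_def by linarith+
  obtain q p where q: "0 < q" "q \<le> int (D ^ n)"
    and p: "\<And>i. i < n \<Longrightarrow> \<bar>of_int q * \<zeta> ^ (Suc i) - of_int (p i)\<bar> < 1 / D"
    using Dirichlet_approx_simult[of D n "\<lambda>i. \<zeta> ^ (Suc i)"] D by auto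
  have "\<bar>\<zeta> ^ i * real_of_int q - real_of_int (p (i - 1))\<bar> \<le> 1 * real D powr (- 1)"
    if "i \<in> {1..n}" for i
  proof -
    have "Suc (i - 1) = i" using that by simp
    then show ?thesis
      using p[of "i - 1"] that D by (simp only: powr_minus_divide mult.commute powr_one) auto
  qed
  moreover have "real_of_int \<bar>q\<bar> \<le> 1 * real D powr real n"
    using q D by (simp add: powr_realpow)
       (metis of_int_le_iff of_int_of_nat_eq of_nat_power)
  ultimately show "\<exists>h>B0. \<exists>(x::int) (y::nat \<Rightarrow> int). 1 \<le> \<bar>x\<bar> \<and> real_of_int \<bar>x\<bar> \<le> 1 * h powr real n \<and>
      (\<forall>i\<in>{1..n}. \<bar>\<zeta> ^ i * real_of_int x - real_of_int (y i)\<bar> \<le> 1 * h powr (- 1))"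
    using D q by (intro exI[of _ "real D"] exI[of _ q] exI[of _ "\<lambda>i. p (i - 1)"] conjI) auto
qed (use assms in auto)

text \<open>Pigeonhole over the polynomials with coefficients in 0, ..., Q: two of them have nearly
  equal values at \<open>\<zeta>\<close>, and their difference is the required polynomial.\<close>

lemma dirichlet_poly:
  assumes n: "n \<ge> 1"
  shows "\<exists>C>0. \<forall>Q::nat. Q \<ge> 1 \<longrightarrow> (\<exists>P :: int poly. P \<noteq> 0 \<and> degree P \<le> n \<and> poly_height P \<le> int Q \<and>
    \<bar>poly (map_poly real_of_int P) \<zeta>\<bar> \<le> C / real Q ^ n)"
proof -
  define S where "S = (\<Sum>i\<le>n. \<bar>\<zeta>\<bar> ^ i)"
  have "(\<Sum>i\<in>{0}. \<bar>\<zeta>\<bar> ^ i) \<le> S" unfolding S_def by (intro sum_mono2) auto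
  then have S: "S \<ge> 1" by simp
  show ?thesis
  proof (intro exI[of _ "2 * S"] conjI allI impI)
    show "2 * S > 0" using S by simp
    fix Q :: nat assume Q: "Q \<ge> 1"
    define F where "F = PiE {..n} (\<lambda>_. {0..int Q})"
    \<comment> \<open>All values lie in [-S Q, S Q]. Cells of width 1/r = 2 S / Q^n number fewer
      than Q^(n+1) + 2, which does not exceed the number (Q + 1)^(n+1) of coefficient
      vectors.\<close>
    define r where "r = real Q ^ n / (2 * S)"
    have r: "r > 0" using Q S by (simp add: r_def)
    define val where "val = (\<lambda>f::nat \<Rightarrow> int. \<Sum>i\<le>n. real_of_int (f i) * \<zeta> ^ i)"
    define cell where "cell = (\<lambda>f. \<lfloor>val f * r\<rfloor>)"
    define a where "a = S * real Q * r"
    have a: "a = real Q ^ Suc n / 2" using S by (simp add: a_def r_def)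
    have cardF: "card F = (Q + 1) ^ Suc n" by (simp add: F_def card_PiE nat_add_distrib)
    have valb: "\<bar>val f\<bar> \<le> S * real Q" if "f \<in> F" for f
    proof -
      have "\<bar>val f\<bar> \<le> (\<Sum>i\<le>n. real Q * \<bar>\<zeta>\<bar> ^ i)" unfolding val_def
      proof (intro order_trans[OF sum_abs] sum_mono)
        fix i assume "i \<in> {..n}"
        then have "f i \<in> {0..int Q}" using that by (auto simp: F_def PiE_iff)
        then have "\<bar>real_of_int (f i)\<bar> \<le> real Q" by simp
        then show "\<bar>real_of_int (f i) * \<zeta> ^ i\<bar> \<le> real Q * \<bar>\<zeta>\<bar> ^ i"
          by (simp add: abs_mult power_abs mult_right_mono)
      qed
      also have "\<dots> = S * real Q" by (simp add: S_def sum_distrib_left mult.commute)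
      finally show ?thesis .
    qed
    have "cell ` F \<subseteq> {\<lfloor>- a\<rfloor>..\<lfloor>a\<rfloor>}"
    proof safe
      fix f assume "f \<in> F"
      from valb[OF this] have "\<bar>val f * r\<bar> \<le> a" using r by (simp add: a_def abs_mult)
      then show "cell f \<in> {\<lfloor>- a\<rfloor>..\<lfloor>a\<rfloor>}" unfolding cell_def by (auto intro!: floor_mono)
    qed
    then have "card (cell ` F) \<le> card {\<lfloor>- a\<rfloor>..\<lfloor>a\<rfloor>}" by (intro card_mono) auto
    also have "\<dots> = nat (\<lfloor>a\<rfloor> - \<lfloor>- a\<rfloor> + 1)" by simp
    finally have "card (cell ` F) \<le> nat (\<lfloor>a\<rfloor> - \<lfloor>- a\<rfloor> + 1)" .
    moreover have "a \<ge> 0" by (simp add: a)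
    ultimately have "real (card (cell ` F)) < 2 * a + 2" by linarith
    also have "\<dots> = real (Q ^ Suc n + 2)" by (simp add: a)
    finally have "card (cell ` F) < Q ^ Suc n + 2" by linarith
    also have "\<dots> \<le> (Q + 1) ^ Suc n"
    proof -
      have "Q ^ n < (Q + 1) ^ n" using n by (intro power_strict_mono) auto
      then have "(Q + 1) * (Q ^ n + 1) \<le> (Q + 1) * (Q + 1) ^ n" by (intro mult_left_mono) auto
      then show ?thesis using Q by simp
    qed
    also have "\<dots> = card F" by (simp add: cardF)
    finally have "\<not> inj_on cell F" by (rule pigeonhole)
    then obtain f g where fg: "f \<in> F" "g \<in> F" "f \<noteq> g" "cell f = cell g"
      by (auto simp: inj_on_def)
    define P where "P = (\<Sum>i\<le>n. monom (f i - g i) i)"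
    have coeffP: "coeff P i = (if i \<le> n then f i - g i else 0)" for i
      by (simp add: P_def coeff_sum if_distrib cong: if_cong)
    have deg: "degree P \<le> n" by (intro degree_le) (auto simp: coeffP)
    obtain i where i: "i \<le> n" "f i \<noteq> g i"
      using fg(1-3) unfolding F_def by (metis PiE_ext atMost_iff)
    have "P \<noteq> 0" using coeffP[of i] i by auto
    moreover have "poly_height P \<le> int Q" unfolding poly_height_le_iff
    proof
      fix j
      show "\<bar>coeff P j\<bar> \<le> int Q"
      proof (cases "j \<le> n")
        case True
        then have "f j \<in> {0..int Q}" "g j \<in> {0..int Q}" using fg by (auto simp: F_def PiE_iff)
        then show ?thesis by (auto simp: coeffP)
      qed (auto simp: coeffP)
    qed
    moreover have "poly (map_poly real_of_int P) \<zeta> = val f - val g"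
      using deg by (simp add: poly_map_real_eq_sum coeffP val_def algebra_simps sum_subtractf)
    moreover have "\<bar>val f - val g\<bar> \<le> 2 * S / real Q ^ n"
    proof -
      have "\<bar>val f * r - val g * r\<bar> \<le> 1" using fg(4) unfolding cell_def by linarith
      then have "\<bar>val f - val g\<bar> * r \<le> 1" using r by (simp add: left_diff_distrib[symmetric] abs_mult)
      then show ?thesis using r Q S by (simp add: r_def field_simps)
    qed
    ultimately show "\<exists>P :: int poly. P \<noteq> 0 \<and> degree P \<le> n \<and> poly_height P \<le> int Q \<and>
      \<bar>poly (map_poly real_of_int P) \<zeta>\<bar> \<le> 2 * S / real Q ^ n" using deg by auto
  qed
qed

text \<open>The Dirichlet polynomials have value O(Q^(-n)) and height at most Q; the gap between w
  and n absorbs the constant.\<close>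

lemma exp_w_ge:
  assumes tr: "\<not> algebraic \<zeta>" and n: "n \<ge> 1"
  shows "ereal (real n) \<le> exp_w n \<zeta>"
proof (rule ereal_le_dense)
  show "0 < real n" using n by simp
  fix w :: real assume w: "0 < w" "w < real n"
  obtain C where C: "C > 0" and dir: "\<And>Q::nat. Q \<ge> 1 \<Longrightarrow>
    \<exists>P :: int poly. P \<noteq> 0 \<and> degree P \<le> n \<and> poly_height P \<le> int Q \<and>
    \<bar>poly (map_poly real_of_int P) \<zeta>\<bar> \<le> C / real Q ^ n"
    using dirichlet_poly[OF n, of \<zeta>] by blast
  show "ereal w \<le> exp_w n \<zeta>"
  proof (rule exp_w_geI[OF tr])
    fix \<epsilon> :: real assume \<epsilon>: "\<epsilon> > 0"
    have "((\<lambda>x. C * x powr (- real n)) \<longlongrightarrow> C * 0) at_top"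
      by (intro tendsto_intros tendsto_neg_powr filterlim_ident) (use n in auto)
    then have e1: "\<forall>\<^sub>F x in at_top. C * x powr (- real n) < \<epsilon>"
      using \<epsilon> by (intro order_tendstoD) auto
    have "((\<lambda>x. C * x powr (w - real n)) \<longlongrightarrow> C * 0) at_top"
      by (intro tendsto_intros tendsto_neg_powr filterlim_ident) (use w in auto)
    then have e2: "\<forall>\<^sub>F x in at_top. C * x powr (w - real n) < 1"
      by (intro order_tendstoD) auto
    have "\<forall>\<^sub>F x in at_top. C * x powr (- real n) < \<epsilon> \<and> C * x powr (w - real n) < 1 \<and> x \<ge> 1"
      using e1 e2 eventually_ge_at_top[of 1] by eventually_elim auto
    then have "\<forall>\<^sub>F Q in sequentially. C * real Q powr (- real n) < \<epsilon> \<and> C * real Q powr (w - real n) < 1 \<and> real Q \<ge> 1"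
      by (rule eventually_compose_filterlim[OF _ filterlim_real_sequentially])
    then obtain Q :: nat where Q: "C * real Q powr (- real n) < \<epsilon>"
      "C * real Q powr (w - real n) < 1" "real Q \<ge> 1"
      using eventually_happens sequentially_bot by blast
    from dir[of Q] Q obtain P :: "int poly" where P: "P \<noteq> 0" "degree P \<le> n" "poly_height P \<le> int Q"
      "\<bar>poly (map_poly real_of_int P) \<zeta>\<bar> \<le> C / real Q ^ n" by auto
    have eq: "C / real Q ^ n = C * real Q powr (- real n)"
      using Q by (simp add: powr_minus_divide powr_realpow)
    have "C * real Q powr (- real n) = C * real Q powr (w - real n) * real Q powr (- w)"
      by (simp flip: powr_add)
    also have "\<dots> \<le> 1 * real Q powr (- w)" using Q by (intro mult_right_mono) auto
    also have "\<dots> \<le> real_of_int (poly_height P) powr (- w)"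
      using poly_height_ge_1[OF P(1)] P(3) w by (simp, intro powr_mono2') auto
    finally show "\<exists>P. P \<noteq> 0 \<and> degree P \<le> n \<and> \<bar>poly (map_poly real_of_int P) \<zeta>\<bar> < \<epsilon> \<and>
      \<bar>poly (map_poly real_of_int P) \<zeta>\<bar> \<le> real_of_int (poly_height P) powr (- w)"
      using P Q eq by (intro exI[of _ P]) auto
  qed
qed

subsection \<open>Integer recurrence sequences close to a geometric progression\<close>

text \<open>The exact recurrence would require dividing the sum by \<open>b 0\<close>. Dividing by
  \<open>\<bar>b 0\<bar>\<close> and restoring the sign leaves a defect equal to the remainder
  modulo \<open>\<bar>b 0\<bar>\<close>, so there are only \<open>\<bar>b 0\<bar>\<close> possible
  defects per step.\<close>

function approx_recurrence :: "(nat \<Rightarrow> int) \<Rightarrow> nat \<Rightarrow> real \<Rightarrow> nat \<Rightarrow> nat \<Rightarrow> int" where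
  "approx_recurrence b k \<theta> q s = (if s < k then \<lfloor>\<theta> ^ s * real q\<rfloor>
    else - sgn (b 0) * ((\<Sum>i\<in>{1..k}. b i * approx_recurrence b k \<theta> q (s - i)) div \<bar>b 0\<bar>))"
  by auto
termination
  by (relation "Wellfounded.measure (\<lambda>(b, k, \<theta>, q, s). s)") auto

declare approx_recurrence.simps [simp del]

text \<open>Rounding the recurrence leaves remainders modulo \<open>b 0\<close>; two starting values whose
  remainders and rounding errors agree are subtracted from each other.\<close>

lemma recurrence_approximation:
  fixes b :: "nat \<Rightarrow> int" and \<theta> :: real and k N D :: nat
  assumes k: "1 \<le> k" "k \<le> N" and b0: "b 0 \<noteq> 0" and D: "D \<ge> 1"
  obtains t :: "nat \<Rightarrow> int" where "1 \<le> t 0" "t 0 \<le> int D ^ (k - 1) * \<bar>b 0\<bar> ^ (N + 1 - k)"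
    "\<And>s. s < k \<Longrightarrow> \<bar>real_of_int (t s) - \<theta> ^ s * real_of_int (t 0)\<bar> \<le> 1 / real D"
    "\<And>s. k \<le> s \<Longrightarrow> s \<le> N \<Longrightarrow> (\<Sum>i\<le>k. b i * t (s - i)) = 0"
proof -
  define z where "z = approx_recurrence b k \<theta>"
  define R where "R = (\<lambda>q s. (\<Sum>i\<in>{1..k}. b i * z q (s - i)) mod \<bar>b 0\<bar>)"
  have z_small: "z q s = \<lfloor>\<theta> ^ s * real q\<rfloor>" if "s < k" for q s
    unfolding z_def using that by (subst approx_recurrence.simps) simp
  have split: "(\<Sum>i\<le>k. f i) = f 0 + (\<Sum>i\<in>{1..k}. f i)" for f :: "nat \<Rightarrow> int"
    by (simp add: atMost_atLeast0 sum.atLeast_Suc_atMost)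
  have rec: "(\<Sum>i\<le>k. b i * z q (s - i)) = R q s" if "k \<le> s" for q s
  proof -
    define S where "S = (\<Sum>i\<in>{1..k}. b i * z q (s - i))"
    have "z q s = - sgn (b 0) * (S div \<bar>b 0\<bar>)"
      unfolding S_def z_def using that by (subst approx_recurrence.simps) simp
    then have "b 0 * z q s = - (\<bar>b 0\<bar> * (S div \<bar>b 0\<bar>))"
      by (simp add: abs_sgn[of "b 0"])
    then have "b 0 * z q s + S = S mod \<bar>b 0\<bar>"
      using mult_div_mod_eq[of "\<bar>b 0\<bar>" S] by linarith
    then show ?thesis unfolding split R_def S_def by simp
  qed
  \<comment> \<open>The index 0 needs no cell because \<open>z q 0\<close> is exactly q. This leaves
    k - 1 fractional parts with \<open>D\<close> cells each and N + 1 - k remainders, whence the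
    bound on \<open>t 0\<close>.\<close>
  define cell where "cell = (\<lambda>q. (restrict (\<lambda>s. \<lfloor>frac (\<theta> ^ s * real q) * real D\<rfloor>) {1..<k},
    restrict (R q) {k..N}))"
  define V where "V = (PiE {1..<k} (\<lambda>_. {0..<int D})) \<times> (PiE {k..N} (\<lambda>_. {0..<\<bar>b 0\<bar>}))"
  define K where "K = D ^ (k - 1) * nat \<bar>b 0\<bar> ^ (N + 1 - k)"
  have cardV: "card V = K" by (simp add: V_def K_def card_PiE card_cartesian_product)
  have finV: "finite V" by (auto simp: V_def intro!: finite_PiE)
  have "cell q \<in> V" for q
  proof -
    have "\<lfloor>frac x * real D\<rfloor> \<in> {0..<int D}" for x
    proof -
      have "0 \<le> frac x" "frac x < 1" by (auto simp: frac_lt_1)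
      then have "0 \<le> frac x * real D" "frac x * real D < real D" using D by auto
      then show ?thesis by (auto simp: floor_less_iff)
    qed
    moreover have "R q s \<in> {0..<\<bar>b 0\<bar>}" for s using b0 by (simp add: R_def)
    ultimately show ?thesis unfolding cell_def V_def by auto
  qed
  then have "card (cell ` {0..K}) \<le> card V" by (intro card_mono finV) auto
  also have "\<dots> < card {0..K}" by (simp add: cardV)
  finally have "\<not> inj_on cell {0..K}" by (rule pigeonhole)
  \<comment> \<open>There are K + 1 parameters for at most K cells; the difference q2 - q1 becomes
    \<open>t 0\<close>, which gives both 1 and K as its bounds.\<close>
  then obtain q1 q2 where q: "q1 \<le> K" "q2 \<le> K" "q1 < q2" "cell q1 = cell q2"
    unfolding inj_on_def by (metis atLeastAtMost_iff linorder_neqE_nat)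
  define t where "t = (\<lambda>s. z q2 s - z q1 s)"
  have z0: "z q 0 = int q" for q using z_small[of 0 q] k by simp
  have t0: "t 0 = int q2 - int q1" by (simp add: t_def z0)
  show ?thesis
  proof (rule that[of t])
    show "1 \<le> t 0" using t0 q by simp
    have "t 0 \<le> int K" using t0 q by simp
    then show "t 0 \<le> int D ^ (k - 1) * \<bar>b 0\<bar> ^ (N + 1 - k)" by (simp add: K_def)
  next
    fix s assume s: "s < k"
    show "\<bar>real_of_int (t s) - \<theta> ^ s * real_of_int (t 0)\<bar> \<le> 1 / real D"
    proof (cases "s = 0")
      case False
      define x where "x = (\<lambda>q. \<theta> ^ s * real q)"
      have "fst (cell q1) s = fst (cell q2) s" using q by simp
      then have "\<lfloor>frac (x q1) * real D\<rfloor> = \<lfloor>frac (x q2) * real D\<rfloor>"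
        using False s by (simp add: cell_def x_def)
      then have "\<bar>frac (x q1) * real D - frac (x q2) * real D\<bar> \<le> 1" by linarith
      then have "\<bar>frac (x q1) - frac (x q2)\<bar> * real D \<le> 1"
        by (simp add: left_diff_distrib[symmetric] abs_mult)
      then have "\<bar>frac (x q1) - frac (x q2)\<bar> \<le> 1 / real D" using D by (simp add: field_simps)
      moreover have "real_of_int (t s) - \<theta> ^ s * real_of_int (t 0) = frac (x q1) - frac (x q2)"
        using s by (simp add: t_def z0 z_small x_def frac_def algebra_simps)
      ultimately show ?thesis by simp
    qed simp
  next
    fix s assume s: "k \<le> s" "s \<le> N"
    have "snd (cell q1) s = snd (cell q2) s" using q by simp
    then have "R q1 s = R q2 s" using s by (simp add: cell_def)
    then show "(\<Sum>i\<le>k. b i * t (s - i)) = 0"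
      using rec[OF s(1), of q1] rec[OF s(1), of q2]
      by (simp add: t_def right_diff_distrib sum_subtractf)
  qed
qed

text \<open>Discrete Gronwall argument: each application of the recurrence enlarges the bound by at
  most the factor 1 + a k + g. The summand 1 keeps the factor at least 1, so that its powers
  increase.\<close>

lemma recurrence_error_bound:
  fixes e :: "nat \<Rightarrow> real"
  assumes k: "1 \<le> k" and nn: "0 \<le> a" "0 \<le> g" "0 \<le> \<delta>"
    and init: "\<And>s. s < k \<Longrightarrow> \<bar>e s\<bar> \<le> \<delta>"
    and step: "\<And>s. k \<le> s \<Longrightarrow> s \<le> N \<Longrightarrow> \<bar>e s\<bar> \<le> a * (\<Sum>i\<in>{1..k}. \<bar>e (s - i)\<bar>) + g * \<delta>"
    and s: "s \<le> N"
  shows "\<bar>e s\<bar> \<le> (1 + a * real k + g) ^ s * \<delta>"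
  using s
proof (induction s rule: less_induct)
  case (less s)
  define L where "L = 1 + a * real k + g"
  have L: "L \<ge> 1" using nn by (simp add: L_def)
  show ?case
  proof (cases "s < k")
    case True
    have "1 * \<delta> \<le> L ^ s * \<delta>" using L nn by (intro mult_right_mono one_le_power) auto
    then show ?thesis using init[OF True] by (simp add: L_def)
  next
    case False
    then have s: "k \<le> s" "1 \<le> s" using k by auto
    have "\<bar>e (s - i)\<bar> \<le> L ^ (s - 1) * \<delta>" if "i \<in> {1..k}" for i
    proof -
      have "\<bar>e (s - i)\<bar> \<le> L ^ (s - i) * \<delta>" unfolding L_def
        using that s less.prems by (intro less.IH) auto
      also have "\<dots> \<le> L ^ (s - 1) * \<delta>"
        using that L nn by (intro mult_right_mono power_increasing) auto
      finally show ?thesis .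
    qed
    then have "(\<Sum>i\<in>{1..k}. \<bar>e (s - i)\<bar>) \<le> real k * (L ^ (s - 1) * \<delta>)"
      using sum_bounded_above[of "{1..k}" "\<lambda>i. \<bar>e (s - i)\<bar>" "L ^ (s - 1) * \<delta>"] by simp
    then have "a * (\<Sum>i\<in>{1..k}. \<bar>e (s - i)\<bar>) \<le> a * (real k * (L ^ (s - 1) * \<delta>))"
      using nn by (intro mult_left_mono)
    moreover have "g * (1 * \<delta>) \<le> g * (L ^ (s - 1) * \<delta>)"
      using L nn by (intro mult_left_mono mult_right_mono one_le_power) auto
    moreover have "0 \<le> L ^ (s - 1) * \<delta>" using L nn by auto
    ultimately have "\<bar>e s\<bar> \<le> L * (L ^ (s - 1) * \<delta>)"
      using step[OF s(1) less.prems] by (simp add: L_def algebra_simps)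
    also have "\<dots> = L ^ s * \<delta>" using s by (simp add: power_eq_if)
    finally show ?thesis by (simp add: L_def)
  qed
qed

subsection \<open>Shifting a polynomial\<close>

text \<open>These are the coefficients of P(T + c), padded with zeros up to degree
  \<open>k\<close>.\<close>

definition shift_coeff :: "int poly \<Rightarrow> nat \<Rightarrow> int \<Rightarrow> nat \<Rightarrow> int" where
  "shift_coeff P k c i = (\<Sum>j\<le>k. coeff P j * int (j choose i) * c ^ (j - i))"

lemma shift_coeff_0: "degree P \<le> k \<Longrightarrow> shift_coeff P k c 0 = poly P c"
  by (simp add: shift_coeff_def poly_eq_sum)

lemma binomial_sum_extend:
  fixes x c :: real
  assumes "j \<le> k"
  shows "(x + c) ^ j = (\<Sum>i\<le>k. real (j choose i) * x ^ i * c ^ (j - i))"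
proof -
  have "(x + c) ^ j = (\<Sum>i\<le>j. real (j choose i) * x ^ i * c ^ (j - i))"
    by (simp add: binomial_ring)
  also have "\<dots> = (\<Sum>i\<le>k. real (j choose i) * x ^ i * c ^ (j - i))"
    using assms by (intro sum.mono_neutral_left) auto
  finally show ?thesis .
qed

lemma sum_shift_coeff:
  assumes "degree P \<le> k"
  shows "(\<Sum>i\<le>k. real_of_int (shift_coeff P k c i) * x ^ i) =
    poly (map_poly real_of_int P) (x + real_of_int c)"
proof -
  have "poly (map_poly real_of_int P) (x + real_of_int c) =
    (\<Sum>j\<le>k. real_of_int (coeff P j) * (\<Sum>i\<le>k. real (j choose i) * x ^ i * real_of_int c ^ (j - i)))"
    using assms by (simp add: poly_map_real_eq_sum binomial_sum_extend)
  also have "\<dots> = (\<Sum>i\<le>k. \<Sum>j\<le>k. real_of_int (coeff P j) * (real (j choose i) * x ^ i * real_of_int c ^ (j - i)))"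
    unfolding sum_distrib_left by (rule sum.swap)
  also have "\<dots> = (\<Sum>i\<le>k. real_of_int (shift_coeff P k c i) * x ^ i)"
    by (simp add: shift_coeff_def sum_distrib_right sum_distrib_left mult_ac)
  finally show ?thesis ..
qed

lemma abs_shift_coeff_le:
  "\<bar>shift_coeff P k c i\<bar> \<le> (1 + \<bar>c\<bar>) ^ k * (int k + 1) * 2 ^ k * poly_height P"
proof -
  have "\<bar>coeff P j * int (j choose i) * c ^ (j - i)\<bar> \<le> poly_height P * 2 ^ k * (1 + \<bar>c\<bar>) ^ k"
    if "j \<le> k" for j
  proof -
    have "j choose i \<le> 2 ^ j" using binomial_le_pow2 by simp
    also have "\<dots> \<le> 2 ^ k" using that by (intro power_increasing) auto
    finally have 1: "int (j choose i) \<le> 2 ^ k" by (metis of_nat_le_iff of_nat_numeral of_nat_power)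
    have "\<bar>c\<bar> ^ (j - i) \<le> (1 + \<bar>c\<bar>) ^ (j - i)" by (intro power_mono) auto
    also have "\<dots> \<le> (1 + \<bar>c\<bar>) ^ k" using that by (intro power_increasing) auto
    finally have 2: "\<bar>c\<bar> ^ (j - i) \<le> (1 + \<bar>c\<bar>) ^ k" .
    show ?thesis unfolding abs_mult power_abs
      using 1 2 by (intro mult_mono abs_coeff_le_poly_height) (auto simp: poly_height_nonneg)
  qed
  then have "\<bar>shift_coeff P k c i\<bar> \<le> (\<Sum>j\<le>k. poly_height P * 2 ^ k * (1 + \<bar>c\<bar>) ^ k)"
    unfolding shift_coeff_def by (intro order_trans[OF sum_abs] sum_mono) auto
  then show ?thesis by (simp add: algebra_simps)
qed

subsection \<open>From one small polynomial to simultaneous approximations\<close>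

text \<open>The exponents balance two errors. Cells of width H^(-B) make \<open>t 0\<close> of size
  at most H^((k-1) B + N + 1 - k), up to a constant. The value of P at \<open>\<zeta>\<close> then
  disturbs each step by \<open>t 0\<close> times H^(-w), divided by a pivot of order H. Requiring
  this to be of order H^(-B) gives k B = w + k - N, and then the exponent of \<open>t 0\<close> is A
  = w + 1 - B.\<close>

lemma going_up_step:
  fixes \<zeta> w :: real and c :: int and C1 :: int
  assumes \<eta>0: "\<zeta> \<noteq> real_of_int c" and k: "1 \<le> k" "k \<le> N" and w: "real N - real k < w" and C1: "C1 \<ge> 1"
  defines "B \<equiv> (w + real k - real N) / real k"
  defines "A \<equiv> w + 1 - B"
  shows "\<exists>C>0. \<exists>h0. \<forall>P. P \<noteq> 0 \<longrightarrow> degree P \<le> k \<longrightarrow> poly_height P \<le> C1 * \<bar>poly P c\<bar> \<longrightarrow>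
    \<bar>poly (map_poly real_of_int P) \<zeta>\<bar> \<le> real_of_int (poly_height P) powr (- w) \<longrightarrow>
    h0 < real_of_int (poly_height P) \<longrightarrow>
    (\<exists>(x::int) (y::nat \<Rightarrow> int). 1 \<le> \<bar>x\<bar> \<and> real_of_int \<bar>x\<bar> \<le> C * real_of_int (poly_height P) powr A \<and>
      (\<forall>i\<in>{1..N}. \<bar>\<zeta> ^ i * real_of_int x - real_of_int (y i)\<bar> \<le> C * real_of_int (poly_height P) powr (- B)))"
proof -
  define \<eta> where "\<eta> = \<zeta> - real_of_int c"
  define \<theta> where "\<theta> = 1 / \<eta>"
  have \<eta>: "\<eta> \<noteq> 0" "\<zeta> = real_of_int c + \<eta>" using \<eta>0 by (auto simp: \<eta>_def)
  have B: "B > 0" using w k by (simp add: B_def)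
  have kB: "real k * B = w + real k - real N" using k by (simp add: B_def)
  have A: "A = B * real (k - 1) + real (N + 1 - k)" using kB k by (simp add: A_def of_nat_diff algebra_simps)
  have A0: "A > 0" unfolding A using B k by (intro add_nonneg_pos) auto
  define C2 where "C2 = real_of_int ((1 + \<bar>c\<bar>) ^ k * (int k + 1) * 2 ^ k)"
  have C2: "C2 > 0" by (simp add: C2_def add_pos_nonneg)
  define C3 where "C3 = 2 ^ (k - 1) * C2 ^ (N + 1 - k)"
  have C3: "C3 > 0" using C2 by (simp add: C3_def)
  define M where "M = (1 + \<bar>\<theta>\<bar>) ^ N"
  define M' where "M' = (1 + \<bar>\<eta>\<bar>) ^ N"
  have M: "\<bar>\<theta>\<bar> ^ s \<le> M" if "s \<le> N" for s
    unfolding M_def using that by (intro order_trans[OF power_mono power_increasing]) auto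
  have M': "\<bar>\<eta>\<bar> ^ s \<le> M'" if "s \<le> N" for s
    unfolding M'_def using that by (intro order_trans[OF power_mono power_increasing]) auto
  have M0: "M \<ge> 1" "M' \<ge> 1" unfolding M_def M'_def by (auto intro!: one_le_power)
  define a where "a = real_of_int C1 * C2"
  define g where "g = real_of_int C1 * C3 * M"
  have ag: "a \<ge> 0" "g \<ge> 0" using C1 C2 C3 M0 by (auto simp: a_def g_def)
  define K where "K = (1 + a * real k + g) ^ N"
  have K1: "K \<ge> 1" unfolding K_def using ag by (intro one_le_power) auto
  define C4 where "C4 = (1 + M') * K"
  have C4: "C4 > 0" using M0 K1 by (simp add: C4_def)
  define C where "C = (1 + \<bar>real_of_int c\<bar>) ^ N * C4 + (M * C3 + K)"
  have C0: "(1 + \<bar>real_of_int c\<bar>) ^ N * C4 > 0" using C4 by (intro mult_pos_pos zero_less_power) auto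
  have C0': "M * C3 + K > 0" using M0 C3 K1 by (intro add_pos_pos mult_pos_pos) auto
  have Cpos: "C > 0" unfolding C_def using C0 C0' by linarith
  \<comment> \<open>For heights beyond \<open>h0\<close> the final error is below 1; this will
    exclude a zero denominator.\<close>
  have "((\<lambda>h. C4 * h powr (- B)) \<longlongrightarrow> C4 * 0) at_top"
    by (intro tendsto_intros tendsto_neg_powr filterlim_ident) (use B in auto)
  then have "\<forall>\<^sub>F h in at_top. C4 * h powr (- B) < 1" by (intro order_tendstoD) auto
  then obtain h0 where h0: "\<And>h. h > h0 \<Longrightarrow> C4 * h powr (- B) < 1"
    unfolding eventually_at_top_dense by blast
  show ?thesis
  proof (rule exI[of _ C], rule conjI[OF Cpos], rule exI[of _ h0], intro allI impI)
    fix P :: "int poly"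
    define H where "H = real_of_int (poly_height P)"
    assume P: "P \<noteq> 0" "degree P \<le> k" "poly_height P \<le> C1 * \<bar>poly P c\<bar>"
      and "\<bar>poly (map_poly real_of_int P) \<zeta>\<bar> \<le> real_of_int (poly_height P) powr (- w)"
      and "h0 < real_of_int (poly_height P)"
    then have val: "\<bar>poly (map_poly real_of_int P) \<zeta>\<bar> \<le> H powr (- w)" and Hh: "H > h0"
      by (auto simp: H_def)
    have H1: "H \<ge> 1" using poly_height_ge_1[OF P(1)] by (simp add: H_def)
    define b where "b = shift_coeff P k c"
    have b0P: "b 0 = poly P c" using P by (simp add: b_def shift_coeff_0)
    have Hb0: "H \<le> real_of_int C1 * real_of_int \<bar>b 0\<bar>"
      using P(3) by (simp add: H_def b0P flip: of_int_mult of_int_abs)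
    have b0: "b 0 \<noteq> 0" using Hb0 H1 by auto
    have bb: "\<bar>real_of_int (b i)\<bar> \<le> C2 * H" for i
    proof -
      have "real_of_int \<bar>b i\<bar> \<le> real_of_int ((1 + \<bar>c\<bar>) ^ k * (int k + 1) * 2 ^ k * poly_height P)"
        unfolding b_def of_int_le_iff by (rule abs_shift_coeff_le)
      then show ?thesis unfolding C2_def H_def by (simp only: of_int_mult of_int_abs)
    qed
    have sumb: "(\<Sum>i\<le>k. real_of_int (b i) * \<eta> ^ i) = poly (map_poly real_of_int P) \<zeta>"
      unfolding b_def sum_shift_coeff[OF P(2)] by (simp add: \<eta>_def)
    define D where "D = nat \<lceil>H powr B\<rceil>"
    have HB1: "H powr B \<ge> 1" using H1 B by (simp add: ge_one_powr_ge_zero)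
    have D: "D \<ge> 1" "H powr B \<le> real D" "real D \<le> 2 * H powr B"
      using HB1 unfolding D_def by linarith+
    obtain t where t0: "1 \<le> t 0" "t 0 \<le> int D ^ (k - 1) * \<bar>b 0\<bar> ^ (N + 1 - k)"
      and tinit: "\<And>s. s < k \<Longrightarrow> \<bar>real_of_int (t s) - \<theta> ^ s * real_of_int (t 0)\<bar> \<le> 1 / real D"
      and trec: "\<And>s. k \<le> s \<Longrightarrow> s \<le> N \<Longrightarrow> (\<Sum>i\<le>k. b i * t (s - i)) = 0"
      using recurrence_approximation[OF k, where b = b and D = D and \<theta> = \<theta>] b0 D(1) by blast
    define \<delta> where "\<delta> = H powr (- B)"
    have \<delta>: "\<delta> > 0" "\<delta> \<le> 1" using H1 B powr_mono[of "-B" 0 H] by (auto simp: \<delta>_def)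
    have D\<delta>: "1 / real D \<le> \<delta>" unfolding \<delta>_def powr_minus_divide using D HB1 by (intro frac_le) linarith+
    have t0A: "real_of_int (t 0) \<le> C3 * H powr A"
    proof -
      have "real_of_int (t 0) \<le> real_of_int (int D ^ (k - 1) * \<bar>b 0\<bar> ^ (N + 1 - k))"
        using t0(2) by (simp only: of_int_le_iff)
      also have "\<dots> = real D ^ (k - 1) * \<bar>real_of_int (b 0)\<bar> ^ (N + 1 - k)" by simp
      also have "\<dots> \<le> (2 * H powr B) ^ (k - 1) * (C2 * H) ^ (N + 1 - k)"
        using D bb[of 0] by (intro mult_mono power_mono) auto
      also have "\<dots> = C3 * ((H powr B) ^ (k - 1) * H ^ (N + 1 - k))"
        by (simp add: C3_def power_mult_distrib)
      also have "(H powr B) ^ (k - 1) = H powr (B * real (k - 1))"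
        using H1 by (simp add: powr_realpow[symmetric] powr_powr)
      also have "H ^ (N + 1 - k) = H powr real (N + 1 - k)" using H1 by (simp add: powr_realpow)
      also have "H powr (B * real (k - 1)) * H powr real (N + 1 - k) = H powr A"
        by (simp add: A powr_add)
      finally show ?thesis .
    qed
    define e where "e = (\<lambda>s. real_of_int (t s) - \<theta> ^ s * real_of_int (t 0))"
    \<comment> \<open>The sequence \<open>t\<close> satisfies the recurrence exactly, whereas the
      geometric progression misses it by \<open>\<theta>\<close> ^ s times the value of P at
      \<open>\<zeta>\<close>, because \<open>\<theta>\<close> is the inverse of
      \<open>\<eta>\<close>. Hence \<open>e\<close> satisfies the recurrence up to this term times
      \<open>t 0\<close>.\<close>
    have estep: "\<bar>e s\<bar> \<le> a * (\<Sum>i\<in>{1..k}. \<bar>e (s - i)\<bar>) + g * \<delta>" if s: "k \<le> s" "s \<le> N" for s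
    proof -
      have "(\<Sum>i\<le>k. real_of_int (b i) * e (s - i)) =
        real_of_int (\<Sum>i\<le>k. b i * t (s - i)) - real_of_int (t 0) * (\<Sum>i\<le>k. real_of_int (b i) * \<theta> ^ (s - i))"
        by (simp add: e_def right_diff_distrib sum_subtractf sum_distrib_left mult_ac)
      also have "(\<Sum>i\<le>k. real_of_int (b i) * \<theta> ^ (s - i)) = \<theta> ^ s * (\<Sum>i\<le>k. real_of_int (b i) * \<eta> ^ i)"
        unfolding sum_distrib_left
      proof (rule sum.cong)
        fix i assume "i \<in> {..k}"
        then have "\<theta> ^ s = \<theta> ^ (s - i) * \<theta> ^ i" using s by (simp flip: power_add)
        moreover have "\<theta> ^ i * \<eta> ^ i = 1" using \<eta> by (simp add: \<theta>_def power_mult_distrib[symmetric])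
        ultimately show "real_of_int (b i) * \<theta> ^ (s - i) = \<theta> ^ s * (real_of_int (b i) * \<eta> ^ i)"
          by (metis mult.commute mult.left_commute mult.right_neutral)
      qed simp
      finally have eq: "(\<Sum>i\<le>k. real_of_int (b i) * e (s - i)) =
        - real_of_int (t 0) * (\<theta> ^ s * poly (map_poly real_of_int P) \<zeta>)"
        by (simp add: trec[OF s] sumb)
      have "(\<Sum>i\<le>k. real_of_int (b i) * e (s - i)) =
        real_of_int (b 0) * e s + (\<Sum>i\<in>{1..k}. real_of_int (b i) * e (s - i))"
        by (simp add: atMost_atLeast0 sum.atLeast_Suc_atMost)
      then have "\<bar>real_of_int (b 0) * e s\<bar> \<le> \<bar>\<Sum>i\<in>{1..k}. real_of_int (b i) * e (s - i)\<bar>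
        + \<bar>real_of_int (t 0) * (\<theta> ^ s * poly (map_poly real_of_int P) \<zeta>)\<bar>"
        using eq by linarith
      also have "\<dots> \<le> (\<Sum>i\<in>{1..k}. C2 * H * \<bar>e (s - i)\<bar>) + C3 * H powr A * (M * H powr (- w))"
      proof (intro add_mono)
        show "\<bar>\<Sum>i\<in>{1..k}. real_of_int (b i) * e (s - i)\<bar> \<le> (\<Sum>i\<in>{1..k}. C2 * H * \<bar>e (s - i)\<bar>)"
          by (intro order_trans[OF sum_abs] sum_mono) (auto simp: abs_mult intro!: mult_right_mono bb)
        show "\<bar>real_of_int (t 0) * (\<theta> ^ s * poly (map_poly real_of_int P) \<zeta>)\<bar>
          \<le> C3 * H powr A * (M * H powr (- w))"
          unfolding abs_mult power_abs using t0A t0 M[OF s(2)] val M0 C3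
          by (intro mult_mono) auto
      qed
      finally have 1: "\<bar>real_of_int (b 0)\<bar> * \<bar>e s\<bar> \<le>
        C2 * H * (\<Sum>i\<in>{1..k}. \<bar>e (s - i)\<bar>) + C3 * M * (H powr A * H powr (- w))"
        by (simp add: abs_mult sum_distrib_left mult_ac)
      \<comment> \<open>Here A - w = 1 - B: the disturbance has order H \<open>\<delta>\<close>, and
        division by the pivot \<open>b 0\<close>, which is at least H / C1 in absolute value, brings
        it down to order \<open>\<delta>\<close>.\<close>
      have "H powr A * H powr (- w) = H powr (1 + - B)"
        unfolding powr_add[symmetric] by (simp add: A_def)
      also have "\<dots> = H * \<delta>" using H1 unfolding powr_add \<delta>_def by simp
      finally have 2: "\<bar>real_of_int (b 0)\<bar> * \<bar>e s\<bar> \<le>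
        C2 * H * (\<Sum>i\<in>{1..k}. \<bar>e (s - i)\<bar>) + C3 * M * (H * \<delta>)"
        using 1 by simp
      have "H * \<bar>e s\<bar> \<le> real_of_int C1 * real_of_int \<bar>b 0\<bar> * \<bar>e s\<bar>"
        using Hb0 by (intro mult_right_mono) auto
      also have "\<dots> = real_of_int C1 * (\<bar>real_of_int (b 0)\<bar> * \<bar>e s\<bar>)" by simp
      also have "\<dots> \<le> real_of_int C1 * (C2 * H * (\<Sum>i\<in>{1..k}. \<bar>e (s - i)\<bar>) + C3 * M * (H * \<delta>))"
        using 2 C1 by (intro mult_left_mono) auto
      also have "\<dots> = H * (a * (\<Sum>i\<in>{1..k}. \<bar>e (s - i)\<bar>) + g * \<delta>)"
        by (simp add: a_def g_def algebra_simps)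
      finally show ?thesis using H1 by simp
    qed
    have eb: "\<bar>e s\<bar> \<le> K * \<delta>" if "s \<le> N" for s
    proof -
      have "\<bar>e s\<bar> \<le> (1 + a * real k + g) ^ s * \<delta>"
      proof (rule recurrence_error_bound[OF k(1) ag less_imp_le[OF \<delta>(1)] _ estep that])
        show "\<bar>e s\<bar> \<le> \<delta>" if "s < k" for s using tinit[OF that] D\<delta> by (simp add: e_def)
      qed
      also have "\<dots> \<le> K * \<delta>" unfolding K_def
        using that ag \<delta> by (intro mult_right_mono power_increasing) auto
      finally show ?thesis .
    qed
    \<comment> \<open>Reading the sequence backwards replaces the ratio 1/\<open>\<eta>\<close> by
      \<open>\<eta>\<close>.\<close>
    define u where "u = (\<lambda>j. t (N - j))"
    have ub: "\<bar>real_of_int (u j) - \<eta> ^ j * real_of_int (u 0)\<bar> \<le> C4 * \<delta>" if "j \<le> N" for j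
    proof -
      have "\<eta> ^ j * \<theta> ^ N = \<theta> ^ (N - j)"
      proof -
        have "\<theta> ^ N = \<theta> ^ (N - j) * \<theta> ^ j" using that by (simp flip: power_add)
        moreover have "\<theta> ^ j * \<eta> ^ j = 1" using \<eta> by (simp add: \<theta>_def power_mult_distrib[symmetric])
        ultimately show ?thesis by (simp add: mult_ac)
      qed
      then have "real_of_int (u j) - \<eta> ^ j * real_of_int (u 0) = e (N - j) - \<eta> ^ j * e N"
        by (simp add: u_def e_def algebra_simps)
      also have "\<bar>\<dots>\<bar> \<le> \<bar>e (N - j)\<bar> + \<bar>\<eta>\<bar> ^ j * \<bar>e N\<bar>"
        by (metis abs_mult abs_triangle_ineq4 power_abs)
      also have "\<dots> \<le> K * \<delta> + M' * (K * \<delta>)"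
        using eb[of "N - j"] eb[of N] M'[OF that] M0 by (intro add_mono mult_mono) auto
      finally show ?thesis by (simp add: C4_def algebra_simps)
    qed
    have C4\<delta>: "C4 * \<delta> < 1" using h0[OF Hh] by (simp add: \<delta>_def)
    \<comment> \<open>If \<open>u 0\<close> vanished, \<open>u N\<close> would lie within distance
      less than 1 of 0, although it equals \<open>t 0\<close>, a positive integer.\<close>
    have "u 0 \<noteq> 0"
    proof
      assume "u 0 = 0"
      then have "\<bar>real_of_int (u N)\<bar> < 1" using ub[of N] C4\<delta> by simp
      then show False using t0 by (simp add: u_def)
    qed
    then have x1: "1 \<le> \<bar>u 0\<bar>" by simp
    have x2: "real_of_int \<bar>u 0\<bar> \<le> C * H powr A"
    proof -
      have HA: "H powr A \<ge> 1" using H1 A0 by (simp add: ge_one_powr_ge_zero)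
      have "real_of_int (u 0) = e N + \<theta> ^ N * real_of_int (t 0)" by (simp add: u_def e_def)
      then have "real_of_int \<bar>u 0\<bar> \<le> \<bar>e N\<bar> + \<bar>\<theta> ^ N * real_of_int (t 0)\<bar>" by simp
      also have "\<dots> \<le> K * \<delta> + M * (C3 * H powr A)"
        unfolding abs_mult power_abs using eb[of N] M[of N] t0 t0A M0 by (intro add_mono mult_mono) auto
      also have "\<dots> \<le> K * H powr A + M * (C3 * H powr A)"
        using K1 \<delta> HA M0 C3 by (intro add_mono mult_left_mono) auto
      also have "\<dots> = (M * C3 + K) * H powr A" by (simp add: algebra_simps)
      also have "\<dots> \<le> C * H powr A" unfolding C_def using C0 by (intro mult_right_mono) auto
      finally show ?thesis .
    qed
    \<comment> \<open>The binomial transform undoes the shift: it carries powers of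
      \<open>\<eta>\<close> to powers of \<open>\<eta>\<close> + c = \<open>\<zeta>\<close> and
      preserves integrality.\<close>
    define v where "v = (\<lambda>i. \<Sum>j\<le>i. int (i choose j) * u j * c ^ (i - j))"
    have vb: "\<bar>\<zeta> ^ i * real_of_int (u 0) - real_of_int (v i)\<bar> \<le> C * H powr (- B)"
      if "i \<in> {1..N}" for i
    proof -
      have "\<zeta> ^ i = (\<Sum>j\<le>i. real (i choose j) * \<eta> ^ j * real_of_int c ^ (i - j))"
        using binomial_ring[of \<eta> "real_of_int c" i] by (simp add: \<eta>_def)
      then have "real_of_int (v i) - \<zeta> ^ i * real_of_int (u 0) =
        (\<Sum>j\<le>i. real (i choose j) * real_of_int c ^ (i - j) * (real_of_int (u j) - \<eta> ^ j * real_of_int (u 0)))"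
        by (simp add: v_def sum_distrib_right sum_distrib_left right_diff_distrib sum_subtractf mult_ac)
      also have "\<bar>\<dots>\<bar> \<le> (\<Sum>j\<le>i. real (i choose j) * \<bar>real_of_int c\<bar> ^ (i - j) * (C4 * \<delta>))"
      proof (intro order_trans[OF sum_abs] sum_mono)
        fix j assume "j \<in> {..i}"
        then have "j \<le> N" using that by auto
        from ub[OF this] show "\<bar>real (i choose j) * real_of_int c ^ (i - j) * (real_of_int (u j) - \<eta> ^ j * real_of_int (u 0))\<bar>
          \<le> real (i choose j) * \<bar>real_of_int c\<bar> ^ (i - j) * (C4 * \<delta>)"
          unfolding abs_mult power_abs by (intro mult_mono) auto
      qed
      also have "\<dots> = (1 + \<bar>real_of_int c\<bar>) ^ i * (C4 * \<delta>)"
        using binomial_ring[of 1 "\<bar>real_of_int c\<bar>" i] by (simp add: sum_distrib_right)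
      also have "\<dots> \<le> (1 + \<bar>real_of_int c\<bar>) ^ N * (C4 * \<delta>)"
        using that C4 \<delta> by (intro mult_right_mono power_increasing) auto
      also have "\<dots> = (1 + \<bar>real_of_int c\<bar>) ^ N * C4 * \<delta>" by simp
      also have "\<dots> \<le> C * \<delta>" unfolding C_def using C0' \<delta> by (intro mult_right_mono) auto
      finally show ?thesis by (simp add: \<delta>_def abs_minus_commute)
    qed
    show "\<exists>(x::int) (y::nat \<Rightarrow> int). 1 \<le> \<bar>x\<bar> \<and> real_of_int \<bar>x\<bar> \<le> C * real_of_int (poly_height P) powr A \<and>
      (\<forall>i\<in>{1..N}. \<bar>\<zeta> ^ i * real_of_int x - real_of_int (y i)\<bar> \<le> C * real_of_int (poly_height P) powr (- B))"
      using x1 x2 vb unfolding H_def by blast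
  qed
qed

text \<open>Only k + 1 shifts are possible, so one shift \<open>c\<close> serves infinitely many of
  the small polynomials. The stated fraction is B / A from the previous construction with numerator
  and denominator multiplied by k.\<close>

lemma exp_lambda_going_up:
  assumes tr: "\<not> algebraic \<zeta>" and k: "1 \<le> k" "k \<le> N"
    and w: "real N - real k < w" "ereal w < exp_w k \<zeta>"
  shows "ereal ((w + real k - real N) / ((real k - 1) * w + real N)) \<le> exp_lambda N \<zeta>"
proof -
  define S where "S = {P :: int poly. degree P \<le> k \<and> P \<noteq> 0 \<and>
      \<bar>poly (map_poly real_of_int P) \<zeta>\<bar> \<le> real_of_int (poly_height P) powr (- w)}"
  have infS: "infinite S" unfolding S_def by (rule exp_w_greaterD[OF w(2)])
  obtain C1 where C1: "C1 \<ge> 1" and Cv: "\<And>P :: int poly. degree P \<le> k \<Longrightarrow>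
    (\<exists>c\<in>{0..int k}. poly_height P \<le> C1 * \<bar>poly P c\<bar>)" using poly_height_le_value[of k] by blast
  have "\<exists>c\<in>{0..int k}. infinite {P. P \<in> S \<and> poly_height P \<le> C1 * \<bar>poly P c\<bar>}"
    by (rule pigeonhole_infinite_rel[OF infS]) (auto simp: S_def intro!: Cv)
  then obtain c where inf: "infinite {P \<in> S. poly_height P \<le> C1 * \<bar>poly P c\<bar>}" by auto
  define B where "B = (w + real k - real N) / real k"
  define A where "A = w + 1 - B"
  have c: "\<zeta> \<noteq> real_of_int c" using transcendental_irrational[OF tr, of c 1] by simp
  from going_up_step[OF c k w(1) C1] obtain C h0 where C: "C > 0"
    and step: "\<And>P. P \<noteq> 0 \<Longrightarrow> degree P \<le> k \<Longrightarrow> poly_height P \<le> C1 * \<bar>poly P c\<bar> \<Longrightarrow>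
    \<bar>poly (map_poly real_of_int P) \<zeta>\<bar> \<le> real_of_int (poly_height P) powr (- w) \<Longrightarrow>
    h0 < real_of_int (poly_height P) \<Longrightarrow>
    (\<exists>(x::int) (y::nat \<Rightarrow> int). 1 \<le> \<bar>x\<bar> \<and> real_of_int \<bar>x\<bar> \<le> C * real_of_int (poly_height P) powr A \<and>
      (\<forall>i\<in>{1..N}. \<bar>\<zeta> ^ i * real_of_int x - real_of_int (y i)\<bar> \<le> C * real_of_int (poly_height P) powr (- B)))"
    unfolding A_def B_def by blast
  have kA: "real k * A = (real k - 1) * w + real N"
    using k by (simp add: A_def B_def field_simps)
  have "(real k - 1) * w \<ge> 0" using k w by (intro mult_nonneg_nonneg) linarith+
  then have "real k * A > 0" unfolding kA using k by linarith
  then have A0: "A > 0" using k by (simp add: zero_less_mult_iff)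
  have "ereal (B / A) \<le> exp_lambda N \<zeta>"
  proof (rule exp_lambda_geI[OF _ A0 C])
    show "1 \<le> N" using k by simp
    fix B0 :: real
    define b where "b = max B0 h0"
    have "\<not> {P \<in> S. poly_height P \<le> C1 * \<bar>poly P c\<bar>} \<subseteq> {P. degree P \<le> k \<and> poly_height P \<le> \<lceil>b\<rceil>}"
      using inf finite_bounded_height finite_subset by blast
    then obtain P where "P \<in> {P \<in> S. poly_height P \<le> C1 * \<bar>poly P c\<bar>}"
      "P \<notin> {P. degree P \<le> k \<and> poly_height P \<le> \<lceil>b\<rceil>}" by blast
    then have P: "P \<in> S" "poly_height P \<le> C1 * \<bar>poly P c\<bar>" "poly_height P > \<lceil>b\<rceil>"
      by (auto simp: S_def)
    from P(3) have "real_of_int (poly_height P) > b" by linarith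
    then have big: "real_of_int (poly_height P) > B0" "real_of_int (poly_height P) > h0"
      by (auto simp: b_def)
    have "\<exists>(x::int) (y::nat \<Rightarrow> int). 1 \<le> \<bar>x\<bar> \<and> real_of_int \<bar>x\<bar> \<le> C * real_of_int (poly_height P) powr A \<and>
      (\<forall>i\<in>{1..N}. \<bar>\<zeta> ^ i * real_of_int x - real_of_int (y i)\<bar> \<le> C * real_of_int (poly_height P) powr (- B))"
      using P big by (intro step) (auto simp: S_def)
    then show "\<exists>h>B0. \<exists>(x::int) (y::nat \<Rightarrow> int). 1 \<le> \<bar>x\<bar> \<and> real_of_int \<bar>x\<bar> \<le> C * h powr A \<and>
      (\<forall>i\<in>{1..N}. \<bar>\<zeta> ^ i * real_of_int x - real_of_int (y i)\<bar> \<le> C * h powr (- B))"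
      using big(1) by blast
  qed
  moreover have "B / A = (real k * B) / (real k * A)" using k by simp
  moreover have "real k * B = w + real k - real N" using k by (simp add: B_def)
  ultimately show ?thesis by (simp add: kA)
qed

subsection \<open>Bezout identities with degree bounds\<close>

text \<open>Gauss's lemma: for primitive G the content of the cofactor is that of a p, so the factor
  \<open>a\<close> can be cancelled from it.\<close>

lemma primitive_dvd_smult:
  fixes G p :: "int poly"
  assumes G: "content G = 1" and a: "a \<noteq> 0" and dvd: "G dvd smult a p"
  shows "G dvd p"
proof -
  obtain h where h: "smult a p = G * h" using dvd by (elim dvdE)
  have "content h = \<bar>a\<bar> * content p"
    using arg_cong[OF h, of content] G by (simp add: content_mult)
  then have "h = smult (\<bar>a\<bar> * content p) (primitive_part h)"
    by (metis content_times_primitive_part)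
  also have "\<bar>a\<bar> * content p = a * (sgn a * content p)" by (simp add: abs_sgn)
  finally have "smult a p = smult a (G * smult (sgn a * content p) (primitive_part h))"
    using h by (metis mult_smult_right smult_smult)
  then have "p = G * smult (sgn a * content p) (primitive_part h)"
    using a by (metis smult_cancel)
  then show ?thesis by (rule dvdI)
qed

text \<open>The integer polynomials are not a Euclidean ring, so a nonzero element of least degree
  in the ideal is combined with pseudo-division. Its primitive part divides p and q, hence is a
  unit, and the element is a constant.\<close>

lemma bezout_int_poly:
  fixes p q :: "int poly"
  assumes cop: "coprime p q"
  shows "\<exists>A B r. r \<noteq> 0 \<and> A * p + B * q = [:r:]"
proof -
  define J where "J = (\<lambda>F. F \<noteq> 0 \<and> (\<exists>A B. F = A * p + B * q))"
  have "p \<noteq> 0 \<or> q \<noteq> 0" using cop by auto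
  then have "\<exists>F. J F"
  proof
    assume "p \<noteq> 0"
    then have "J p" unfolding J_def by (metis add.right_neutral mult_1 mult_zero_left)
    then show ?thesis ..
  next
    assume "q \<noteq> 0"
    then have "J q" unfolding J_def by (metis add_0 mult_1 mult_zero_left)
    then show ?thesis ..
  qed
  then obtain F where F: "J F" and min: "\<And>F'. J F' \<Longrightarrow> degree F \<le> degree F'"
    using ex_has_least_nat[of J _ degree] by blast
  from F obtain A B where AB: "F \<noteq> 0" "F = A * p + B * q" unfolding J_def by blast
  define G where "G = primitive_part F"
  have G: "content G = 1" "F = smult (content F) G" using AB by (auto simp: G_def)
  have dvd: "G dvd A' * p + B' * q" for A' B'
  proof -
    define u where "u = A' * p + B' * q"
    obtain a Q where a: "a \<noteq> 0" "smult a u = F * Q + pseudo_mod u F"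
      and deg: "pseudo_mod u F = 0 \<or> degree (pseudo_mod u F) < degree F"
      using pseudo_mod[OF AB(1), of u] by blast
    have "pseudo_mod u F = smult a u - F * Q" using a by simp
    also have "\<dots> = (smult a A' - A * Q) * p + (smult a B' - B * Q) * q"
      unfolding u_def by (subst AB(2)) (simp add: algebra_simps smult_add_right)
    finally have "pseudo_mod u F \<noteq> 0 \<Longrightarrow> J (pseudo_mod u F)" unfolding J_def by blast
    then have "pseudo_mod u F = 0" using deg min by fastforce
    then have "smult a u = G * smult (content F) Q" using a G(2) by (metis add.right_neutral mult_smult_left mult_smult_right)
    then have "G dvd smult a u" by (rule dvdI)
    then show ?thesis using primitive_dvd_smult[OF G(1) a(1)] by (simp add: u_def)
  qed
  have "G dvd p" "G dvd q" using dvd[of 1 0] dvd[of 0 1] by auto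
  then have "is_unit G" using cop by (meson coprime_common_divisor)
  then have "degree G = 0" by (auto simp: is_unit_poly_iff)
  then have "degree F = 0" by (simp add: G_def)
  then obtain r where "F = [:r:]" by (elim degree_eq_zeroE)
  then show ?thesis using AB by (intro exI[of _ A] exI[of _ B] exI[of _ r]) auto
qed

text \<open>Reducing A modulo q by pseudo-division makes its degree small. The degree of B is then
  forced, since B q differs from -A p by a constant.\<close>

lemma bezout_int_poly_degree:
  fixes p q :: "int poly"
  assumes cop: "coprime p q" and nz: "p \<noteq> 0" "q \<noteq> 0"
  shows "\<exists>A B r. r \<noteq> 0 \<and> A * p + B * q = [:r:] \<and> degree A \<le> degree q - 1 \<and> degree B \<le> degree p - 1"
proof -
  obtain A B r where r: "r \<noteq> 0" and AB: "A * p + B * q = [:r:]"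
    using bezout_int_poly[OF cop] by blast
  obtain a C where a: "a \<noteq> 0" "smult a A = q * C + pseudo_mod A q"
    and deg: "pseudo_mod A q = 0 \<or> degree (pseudo_mod A q) < degree q"
    using pseudo_mod[OF nz(2), of A] by blast
  define A' where "A' = pseudo_mod A q"
  define B' where "B' = C * p + smult a B"
  have A': "A' = smult a A - q * C" using a by (simp add: A'_def)
  have "A' * p + B' * q = smult a (A * p + B * q)"
    unfolding A' B'_def by (simp add: algebra_simps smult_add_right)
  then have eq: "A' * p + B' * q = [:a * r:]" by (simp add: AB)
  have degB: "degree B' \<le> degree p - 1"
  proof (cases "B' = 0")
    case False
    have "degree B' + degree q = degree (B' * q)" using False nz by (simp add: degree_mult_eq)
    also have "B' * q = [:a * r:] - A' * p" using eq by (simp add: algebra_simps)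
    also have "degree \<dots> \<le> degree (A' * p)"
      using degree_diff_le_max[of "[:a * r:]" "A' * p"] by simp
    finally have *: "degree B' + degree q \<le> degree (A' * p)" .
    show ?thesis
    proof (cases "A' = 0")
      case True
      then show ?thesis using * by simp
    next
      case False
      then have "degree A' < degree q" using deg by (simp add: A'_def)
      then show ?thesis using * False nz by (simp add: degree_mult_eq)
    qed
  qed simp
  have "degree A' \<le> degree q - 1" using deg by (auto simp: A'_def)
  then show ?thesis using eq degB a r
    by (intro exI[of _ A'] exI[of _ B'] exI[of _ "a * r"]) simp
qed

subsection \<open>From simultaneous approximations to one small polynomial\<close>

definition coeff_pairing :: "(nat \<Rightarrow> int) \<Rightarrow> nat \<Rightarrow> int poly \<Rightarrow> int" where
  "coeff_pairing v N P = (\<Sum>i\<le>N. coeff P i * v i)"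

lemma coeff_pairing_add: "coeff_pairing v N (P + Q) = coeff_pairing v N P + coeff_pairing v N Q"
  by (simp add: coeff_pairing_def algebra_simps sum.distrib)

lemma coeff_pairing_smult: "coeff_pairing v N (smult a P) = a * coeff_pairing v N P"
  by (simp add: coeff_pairing_def sum_distrib_left mult.assoc)

lemma coeff_pairing_sum:
  "finite I \<Longrightarrow> coeff_pairing v N (\<Sum>i\<in>I. f i) = (\<Sum>i\<in>I. coeff_pairing v N (f i))"
  by (induction I rule: finite_induct) (simp_all add: coeff_pairing_add, simp add: coeff_pairing_def)

lemma coeff_pairing_mult_eq_0:
  assumes "\<And>j. j \<le> d \<Longrightarrow> coeff_pairing v N (monom 1 j * P) = 0" and "degree A \<le> d"
  shows "coeff_pairing v N (A * P) = 0"
proof -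
  have "A * P = (\<Sum>j\<le>d. monom (coeff A j) j) * P" using assms(2) by (simp add: poly_as_sum_of_monoms')
  also have "\<dots> = (\<Sum>j\<le>d. smult (coeff A j) (monom 1 j * P))"
    by (simp add: sum_distrib_right smult_monom flip: mult_smult_left)
  finally show ?thesis using assms(1) by (simp add: coeff_pairing_sum coeff_pairing_smult)
qed

text \<open>As v i is close to x \<open>\<zeta>\<close>^i, the functional is close to x times
  evaluation at \<open>\<zeta>\<close>.\<close>

lemma coeff_pairing_approx:
  assumes "degree P \<le> N" and v: "\<And>i. i \<le> N \<Longrightarrow> \<bar>\<zeta> ^ i * x - real_of_int (v i)\<bar> \<le> \<epsilon>"
  shows "\<bar>real_of_int (coeff_pairing v N P) - x * poly (map_poly real_of_int P) \<zeta>\<bar>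
    \<le> (real N + 1) * real_of_int (poly_height P) * \<epsilon>"
proof -
  have "x * poly (map_poly real_of_int P) \<zeta> - real_of_int (coeff_pairing v N P) =
    (\<Sum>i\<le>N. real_of_int (coeff P i) * (\<zeta> ^ i * x - real_of_int (v i)))"
    using assms(1)
    by (simp add: poly_map_real_eq_sum coeff_pairing_def right_diff_distrib sum_subtractf sum_distrib_left mult_ac)
  also have "\<bar>\<dots>\<bar> \<le> (\<Sum>i\<le>N. real_of_int (poly_height P) * \<epsilon>)"
  proof (intro order_trans[OF sum_abs] sum_mono)
    fix i assume "i \<in> {..N}"
    then show "\<bar>real_of_int (coeff P i) * (\<zeta> ^ i * x - real_of_int (v i))\<bar> \<le> real_of_int (poly_height P) * \<epsilon>"
      unfolding abs_mult using v[of i] abs_coeff_le_poly_height[of P i] poly_height_nonneg[of P]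
      by (intro mult_mono) (auto simp flip: of_int_abs)
  qed
  finally show ?thesis by (simp add: abs_minus_commute algebra_simps)
qed

text \<open>For each monomial multiple of degree at most N, the pairing is an integer within 1/2 of
  a number of modulus at most 1/4, hence zero; linearity extends this to all multipliers
  \<open>A\<close>.\<close>

lemma coeff_pairing_multiples_eq_0:
  assumes deg: "degree P \<le> d" "d \<le> N" and v: "\<And>i. i \<le> N \<Longrightarrow> \<bar>\<zeta> ^ i * x - real_of_int (v i)\<bar> \<le> \<epsilon>"
    and small: "(real N + 1) * real_of_int (poly_height P) * \<epsilon> < 1 / 2"
      "(1 + \<bar>\<zeta>\<bar>) ^ N * \<bar>x * poly (map_poly real_of_int P) \<zeta>\<bar> \<le> 1 / 4"
    and A: "degree A \<le> N - d"
  shows "coeff_pairing v N (A * P) = 0"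
proof (rule coeff_pairing_mult_eq_0[OF _ A])
  fix j assume j: "j \<le> N - d"
  define R where "R = monom 1 j * P"
  have cR: "coeff R i = (if j \<le> i then coeff P (i - j) else 0)" for i
    by (simp add: R_def coeff_monom_mult)
  have degR: "degree R \<le> N"
    by (intro degree_le) (use deg j in \<open>auto simp: cR intro!: coeff_eq_0\<close>)
  have hR: "poly_height R \<le> poly_height P"
    unfolding poly_height_le_iff by (auto simp: cR poly_height_nonneg abs_coeff_le_poly_height)
  have "poly (map_poly real_of_int R) \<zeta> = (\<Sum>i\<le>N. real_of_int (coeff R i) * \<zeta> ^ i)"
    using degR by (rule poly_map_real_eq_sum)
  also have "\<dots> = (\<Sum>i\<in>{j..d + j}. real_of_int (coeff R i) * \<zeta> ^ i)"
    by (intro sum.mono_neutral_right) (use deg j in \<open>auto simp: cR intro!: coeff_eq_0\<close>)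
  also have "\<dots> = (\<Sum>i\<in>{0..d}. real_of_int (coeff R (i + j)) * \<zeta> ^ (i + j))"
    using sum.shift_bounds_cl_nat_ivl[of "\<lambda>i. real_of_int (coeff R i) * \<zeta> ^ i" 0 j d] by simp
  also have "\<dots> = \<zeta> ^ j * poly (map_poly real_of_int P) \<zeta>"
    unfolding poly_map_real_eq_sum[OF deg(1)]
    by (simp add: cR sum_distrib_left power_add mult_ac atMost_atLeast0)
  finally have valR: "poly (map_poly real_of_int R) \<zeta> = \<zeta> ^ j * poly (map_poly real_of_int P) \<zeta>" .
  have "\<bar>\<zeta>\<bar> ^ j \<le> (1 + \<bar>\<zeta>\<bar>) ^ N"
    using j by (intro order_trans[OF power_mono power_increasing]) auto
  then have "\<bar>\<zeta>\<bar> ^ j * \<bar>x * poly (map_poly real_of_int P) \<zeta>\<bar> \<le> 1 / 4"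
    using small(2) by (meson abs_ge_zero mult_right_mono order_trans)
  then have 1: "\<bar>x * poly (map_poly real_of_int R) \<zeta>\<bar> \<le> 1 / 4"
    by (simp add: valR abs_mult power_abs mult_ac)
  have \<epsilon>: "\<epsilon> \<ge> 0" using v[of 0] by (meson abs_ge_zero order_trans zero_le)
  have "(real N + 1) * real_of_int (poly_height R) * \<epsilon> \<le> (real N + 1) * real_of_int (poly_height P) * \<epsilon>"
    using hR \<epsilon> by (intro mult_right_mono mult_left_mono) auto
  moreover have "\<bar>real_of_int (coeff_pairing v N R) - x * poly (map_poly real_of_int R) \<zeta>\<bar>
    \<le> (real N + 1) * real_of_int (poly_height R) * \<epsilon>"
    by (rule coeff_pairing_approx[OF degR v])
  ultimately have "\<bar>real_of_int (coeff_pairing v N R) - x * poly (map_poly real_of_int R) \<zeta>\<bar> < 1 / 2"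
    using small(1) by linarith
  then have "\<bar>real_of_int (coeff_pairing v N R)\<bar> < 1" using 1 by linarith
  then show "coeff_pairing v N (monom 1 j * P) = 0" by (simp add: R_def)
qed

text \<open>The height parameter is Q, about K X^(1/n), where K is fixed by (C /
  \<open>\<kappa>\<close>) X = (K X^(1/n))^n. Rounding Q up costs at most 1, and 1 is at most
  X^(1/n).\<close>

lemma dirichlet_poly_scaled:
  assumes n: "n \<ge> 1" and \<kappa>: "\<kappa> > 0"
  shows "\<exists>C>0. \<forall>X\<ge>1. \<exists>P :: int poly. P \<noteq> 0 \<and> degree P \<le> n \<and>
    real_of_int (poly_height P) \<le> C * X powr (1 / real n) \<and>
    \<bar>poly (map_poly real_of_int P) \<zeta>\<bar> \<le> \<kappa> / X"
proof -
  obtain C where C: "C > 0" and dir: "\<And>Q::nat. Q \<ge> 1 \<Longrightarrow>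
    \<exists>P :: int poly. P \<noteq> 0 \<and> degree P \<le> n \<and> poly_height P \<le> int Q \<and>
    \<bar>poly (map_poly real_of_int P) \<zeta>\<bar> \<le> C / real Q ^ n"
    using dirichlet_poly[OF n, of \<zeta>] by blast
  define K where "K = (C / \<kappa>) powr (1 / real n)"
  have K: "K > 0" using C \<kappa> by (simp add: K_def)
  show ?thesis
  proof (intro exI[of _ "K + 1"] conjI allI impI)
    show "K + 1 > 0" using K by simp
    fix X :: real assume X: "X \<ge> 1"
    define Y where "Y = X powr (1 / real n)"
    have Y: "Y \<ge> 1" using X n by (simp add: Y_def ge_one_powr_ge_zero)
    define Q where "Q = nat \<lceil>K * Y\<rceil>"
    have KY: "K * Y > 0" using K Y by simp
    then have Q: "Q \<ge> 1" "real Q \<ge> K * Y" "real Q \<le> K * Y + 1" unfolding Q_def by linarith+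
    from dir[OF Q(1)] obtain P :: "int poly" where P: "P \<noteq> 0" "degree P \<le> n" "poly_height P \<le> int Q"
      "\<bar>poly (map_poly real_of_int P) \<zeta>\<bar> \<le> C / real Q ^ n" by blast
    have "real_of_int (poly_height P) \<le> real Q" using P(3) by simp
    also have "\<dots> \<le> (K + 1) * Y" using Q(3) Y by (simp add: algebra_simps)
    finally have 1: "real_of_int (poly_height P) \<le> (K + 1) * Y" .
    have "C / \<kappa> * X = (K * Y) ^ n"
      using C \<kappa> X n KY by (simp add: K_def Y_def power_mult_distrib powr_realpow[symmetric] powr_powr)
    also have "\<dots> \<le> real Q ^ n" using Q KY by (intro power_mono) auto
    finally have "C / real Q ^ n \<le> C / (C / \<kappa> * X)"
      using C \<kappa> X Q by (intro divide_left_mono mult_pos_pos) auto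
    also have "\<dots> = \<kappa> / X" using C \<kappa> X by (simp add: field_simps)
    finally have "\<bar>poly (map_poly real_of_int P) \<zeta>\<bar> \<le> \<kappa> / X" using P(4) by linarith
    then show "\<exists>P :: int poly. P \<noteq> 0 \<and> degree P \<le> n \<and>
      real_of_int (poly_height P) \<le> (K + 1) * X powr (1 / real n) \<and>
      \<bar>poly (map_poly real_of_int P) \<zeta>\<bar> \<le> \<kappa> / X"
      using P 1 unfolding Y_def by blast
  qed
qed

lemma exp_w_ge_of_exp_lambda:
  assumes tr: "\<not> algebraic \<zeta>" and n: "1 \<le> n" "2 * n \<le> N + 1" and lam: "ereal (1 / real n) < exp_lambda N \<zeta>"
  shows "ereal (real N - real n) \<le> exp_w n \<zeta>"
proof -
  obtain l where l: "1 / real n < l" "ereal l < exp_lambda N \<zeta>"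
    using ereal_dense2[OF lam] by auto
  have l0: "l > 0" using l n by (meson divide_pos_pos less_trans of_nat_0_less_iff zero_less_one less_le_trans)
  \<comment> \<open>With this \<open>m\<close>, multipliers of degree up to m - 1 are allowed for
    the polynomial of degree n, and up to n - 1 for the one of degree m. These are exactly the
    degrees that Bezout's identity needs.\<close>
  define m where "m = N + 1 - n"
  have m: "n \<le> m" "1 \<le> m" "N - n = m - 1" "N - m = n - 1" "n \<le> N" "m \<le> N" using n by (auto simp: m_def)
  define M where "M = (1 + \<bar>\<zeta>\<bar>) ^ N"
  have M: "M \<ge> 1" unfolding M_def by (intro one_le_power) auto
  define \<kappa> where "\<kappa> = 1 / (4 * M)"
  have \<kappa>: "\<kappa> > 0" using M by (simp add: \<kappa>_def)
  obtain Cn where Cn: "Cn > 0" and dn: "\<And>X. X \<ge> 1 \<Longrightarrow> \<exists>P :: int poly. P \<noteq> 0 \<and> degree P \<le> n \<and>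
    real_of_int (poly_height P) \<le> Cn * X powr (1 / real n) \<and>
    \<bar>poly (map_poly real_of_int P) \<zeta>\<bar> \<le> \<kappa> / X" using dirichlet_poly_scaled[OF n(1) \<kappa>, of \<zeta>] by blast
  obtain Cm where Cm: "Cm > 0" and dm: "\<And>X. X \<ge> 1 \<Longrightarrow> \<exists>P :: int poly. P \<noteq> 0 \<and> degree P \<le> m \<and>
    real_of_int (poly_height P) \<le> Cm * X powr (1 / real m) \<and>
    \<bar>poly (map_poly real_of_int P) \<zeta>\<bar> \<le> \<kappa> / X" using dirichlet_poly_scaled[OF m(2) \<kappa>, of \<zeta>] by blast
  obtain Cd where Cd: "Cd \<ge> 1" and dvdh: "\<And>P G :: int poly. degree P \<le> m \<Longrightarrow> P \<noteq> 0 \<Longrightarrow> G dvd P \<Longrightarrow>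
    poly_height G \<le> Cd * poly_height P" using poly_height_divisor[of m] by blast
  define c where "c = real_of_int Cd * Cm"
  have c: "c > 0" using Cd Cm by (simp add: c_def)
  show ?thesis
  proof (rule exp_w_geI[OF tr])
    fix \<epsilon> :: real assume \<epsilon>: "\<epsilon> > 0"
    have lim: "((\<lambda>X. a * X powr (- s)) \<longlongrightarrow> 0) at_top" if "s > 0" for a s :: real
      using tendsto_mult[OF tendsto_const[of a] tendsto_neg_powr[of "-s" "\<lambda>X. X" at_top]] that
      by (simp add: filterlim_ident)
    \<comment> \<open>The first two conditions make the functional kill the multiples of P and Q,
      the third absorbs all constants in the final exponent, and the fourth makes the value of G
      smaller than \<open>\<epsilon>\<close>.\<close>
    have ev: "\<forall>\<^sub>F X in at_top. (real N + 1) * Cn * X powr (- (l - 1 / real n)) < 1 / 2 \<and>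
      (real N + 1) * Cm * X powr (- (l - 1 / real n)) < 1 / 2 \<and>
      (real N + 1) * c ^ m * X powr (- l) < 1 \<and> (real N + 1) * c * X powr (- l) < \<epsilon>"
      by (intro eventually_conj order_tendstoD(2)[OF lim]) (use l l0 \<epsilon> in auto)
    then obtain X0 where X0: "\<And>X. X > X0 \<Longrightarrow> (real N + 1) * Cn * X powr (- (l - 1 / real n)) < 1 / 2 \<and>
      (real N + 1) * Cm * X powr (- (l - 1 / real n)) < 1 / 2 \<and>
      (real N + 1) * c ^ m * X powr (- l) < 1 \<and> (real N + 1) * c * X powr (- l) < \<epsilon>"
      unfolding eventually_at_top_dense by blast
    have N1: "1 \<le> N" using m n by simp
    from exp_lambda_greaterD[OF tr N1 l0 l(2), of X0] obtain x y where x: "X0 < real_of_int x" "0 < x"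
      and y: "\<And>i. i \<in> {1..N} \<Longrightarrow> \<bar>\<zeta> ^ i * real_of_int x - real_of_int (y i)\<bar> \<le> real_of_int x powr (- l)"
      by blast
    define X where "X = real_of_int x"
    have X1: "X \<ge> 1" using x by (simp add: X_def)
    have bnd: "(real N + 1) * Cn * X powr (- (l - 1 / real n)) < 1 / 2"
      "(real N + 1) * Cm * X powr (- (l - 1 / real n)) < 1 / 2"
      "(real N + 1) * c ^ m * X powr (- l) < 1" "(real N + 1) * c * X powr (- l) < \<epsilon>"
      using X0[OF x(1)] by (auto simp: X_def)
    define v where "v = (\<lambda>i. if i = 0 then x else y i)"
    have v: "\<bar>\<zeta> ^ i * X - real_of_int (v i)\<bar> \<le> X powr (- l)" if "i \<le> N" for i
      using y[of i] that by (auto simp: v_def X_def)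
    from dn[OF X1] obtain P :: "int poly" where P: "P \<noteq> 0" "degree P \<le> n"
      "real_of_int (poly_height P) \<le> Cn * X powr (1 / real n)"
      "\<bar>poly (map_poly real_of_int P) \<zeta>\<bar> \<le> \<kappa> / X" by blast
    from dm[OF X1] obtain Q :: "int poly" where Q: "Q \<noteq> 0" "degree Q \<le> m"
      "real_of_int (poly_height Q) \<le> Cm * X powr (1 / real m)"
      "\<bar>poly (map_poly real_of_int Q) \<zeta>\<bar> \<le> \<kappa> / X" by blast
    have small: "M * \<bar>X * r\<bar> \<le> 1 / 4" if "\<bar>r\<bar> \<le> \<kappa> / X" for r
    proof -
      have "X * \<bar>r\<bar> \<le> \<kappa>" using that X1 by (simp add: field_simps)
      then have "M * (X * \<bar>r\<bar>) \<le> M * \<kappa>" using M by (intro mult_left_mono) auto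
      then show ?thesis using M X1 by (simp add: \<kappa>_def abs_mult)
    qed
    have heights: "(real N + 1) * real_of_int (poly_height R) * X powr (- l) < 1 / 2"
      if "real_of_int (poly_height R) \<le> C * X powr (1 / real n)"
        "(real N + 1) * C * X powr (- (l - 1 / real n)) < 1 / 2" for R C
    proof -
      have "(real N + 1) * real_of_int (poly_height R) * X powr (- l)
        \<le> (real N + 1) * (C * X powr (1 / real n)) * X powr (- l)"
        using that(1) by (intro mult_right_mono mult_left_mono) auto
      also have "\<dots> = (real N + 1) * C * (X powr (1 / real n) * X powr (- l))" by simp
      also have "X powr (1 / real n) * X powr (- l) = X powr (- (l - 1 / real n))"
        by (simp flip: powr_add)
      finally show ?thesis using that(2) by linarith
    qed
    have killP: "coeff_pairing v N (A * P) = 0" if "degree A \<le> N - n" for A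
      using P(2) m(5) v heights[OF P(3) bnd(1)] small[OF P(4)] that
      unfolding M_def by (rule coeff_pairing_multiples_eq_0)
    \<comment> \<open>Because n is at most m, the height of Q also satisfies the weaker bound with
      exponent 1/n, so the smallness condition l > 1/n serves both polynomials.\<close>
    have "Cm * X powr (1 / real m) \<le> Cm * X powr (1 / real n)"
      using Cm X1 m n by (intro mult_left_mono powr_mono divide_left_mono) auto
    then have Q3: "real_of_int (poly_height Q) \<le> Cm * X powr (1 / real n)" using Q(3) by linarith
    have killQ: "coeff_pairing v N (A * Q) = 0" if "degree A \<le> N - m" for A
      using Q(2) m(6) v heights[OF Q3 bnd(2)] small[OF Q(4)] that
      unfolding M_def by (rule coeff_pairing_multiples_eq_0)
    define G where "G = gcd P Q"
    have G0: "G \<noteq> 0" using P by (simp add: G_def)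
    obtain p q where pq: "P = p * G" "Q = q * G" "coprime p q"
      using gcd_coprime_exists[of P Q] G0 unfolding G_def by auto
    have nz: "p \<noteq> 0" "q \<noteq> 0" using pq P Q by auto
    have degs: "degree p + degree G \<le> n" "degree q + degree G \<le> m"
      using P(2) Q(2) pq nz G0 by (auto simp: degree_mult_eq)
    obtain A B r where r: "r \<noteq> 0" "A * p + B * q = [:r:]"
      and AB: "degree A \<le> degree q - 1" "degree B \<le> degree p - 1"
      using bezout_int_poly_degree[OF pq(3) nz] by blast
    \<comment> \<open>The Bezout constant \<open>r\<close> is nonzero, so killing r G kills G
      itself.\<close>
    have "smult r G = (A * p + B * q) * G" by (simp add: r)
    also have "\<dots> = A * P + B * Q" by (simp add: pq algebra_simps)
    finally have "r * coeff_pairing v N G = coeff_pairing v N (A * P + B * Q)"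
      by (metis coeff_pairing_smult)
    also have "\<dots> = 0" unfolding coeff_pairing_add
      using killP[of A] killQ[of B] AB degs m by simp
    finally have pG: "coeff_pairing v N G = 0" using r by simp
    have degG: "degree G \<le> n" using degs by simp
    define H where "H = real_of_int (poly_height G)"
    have H1: "H \<ge> 1" using poly_height_ge_1[OF G0] by (simp add: H_def)
    have "poly_height G \<le> Cd * poly_height Q" by (rule dvdh) (use Q pq in auto)
    then have "H \<le> real_of_int Cd * real_of_int (poly_height Q)"
      unfolding H_def by (metis of_int_le_iff of_int_mult)
    also have "\<dots> \<le> real_of_int Cd * (Cm * X powr (1 / real m))"
      using Cd Q(3) by (intro mult_left_mono) auto
    finally have HX: "H \<le> c * X powr (1 / real m)" by (simp add: c_def)
    have val: "X * \<bar>poly (map_poly real_of_int G) \<zeta>\<bar> \<le> (real N + 1) * H * X powr (- l)"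
      using coeff_pairing_approx[of G N \<zeta> X v "X powr (- l)"] v degG m X1 by (simp add: pG abs_mult H_def)
    have gX: "\<bar>poly (map_poly real_of_int G) \<zeta>\<bar> \<le> (real N + 1) * c * X powr (- l) * (X powr (1 / real m) / X)"
    proof -
      have "(real N + 1) * H * X powr (- l) \<le> (real N + 1) * (c * X powr (1 / real m)) * X powr (- l)"
        using HX by (intro mult_right_mono mult_left_mono) auto
      then have "X * \<bar>poly (map_poly real_of_int G) \<zeta>\<bar> \<le> (real N + 1) * (c * X powr (1 / real m)) * X powr (- l)"
        using val by linarith
      then show ?thesis using X1 by (simp add: field_simps)
    qed
    have "X powr (1 / real m) \<le> X powr 1" using X1 m by (intro powr_mono) auto
    then have "X powr (1 / real m) / X \<le> 1" using X1 by simp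
    then have "(real N + 1) * c * X powr (- l) * (X powr (1 / real m) / X) \<le> (real N + 1) * c * X powr (- l) * 1"
      using c by (intro mult_left_mono) auto
    then have 1: "\<bar>poly (map_poly real_of_int G) \<zeta>\<bar> < \<epsilon>" using gX bnd(4) by linarith
    \<comment> \<open>The m factors X^(1/m), one from the value of G and m - 1 from the powers of H,
      cancel X exactly. The remaining X^(-l) beats the constant, which gives the exponent m - 1 = N
      - n.\<close>
    have "(real N + 1) * c * X powr (- l) * (X powr (1 / real m) / X) * H ^ (m - 1)
      \<le> (real N + 1) * c * X powr (- l) * (X powr (1 / real m) / X) * (c * X powr (1 / real m)) ^ (m - 1)"
      using HX H1 c X1 by (intro mult_left_mono power_mono) auto
    also have "\<dots> = (real N + 1) * (c * c ^ (m - 1)) * X powr (- l) * (X powr (1 / real m) * (X powr (1 / real m)) ^ (m - 1) / X)"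
      by (simp add: power_mult_distrib)
    also have "c * c ^ (m - 1) = c ^ m" using m by (simp add: power_eq_if)
    also have "X powr (1 / real m) * (X powr (1 / real m)) ^ (m - 1) = X"
    proof -
      have "X powr (1 / real m) * (X powr (1 / real m)) ^ (m - 1) = (X powr (1 / real m)) ^ m"
        using m by (simp add: power_eq_if)
      also have "\<dots> = X" using m X1 by (simp add: powr_realpow[symmetric] powr_powr)
      finally show ?thesis .
    qed
    also have "(real N + 1) * c ^ m * X powr (- l) * (X / X) \<le> 1" using bnd(3) X1 by simp
    finally have "(real N + 1) * c * X powr (- l) * (X powr (1 / real m) / X) * H ^ (m - 1) \<le> 1" .
    then have "\<bar>poly (map_poly real_of_int G) \<zeta>\<bar> * H ^ (m - 1) \<le> 1"
      using mult_right_mono[OF gX, of "H ^ (m - 1)"] H1 by simp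
    then have "\<bar>poly (map_poly real_of_int G) \<zeta>\<bar> \<le> 1 / H ^ (m - 1)" using H1 by (simp add: field_simps)
    also have "\<dots> = H powr (- real (m - 1))" using H1 by (simp add: powr_minus_divide powr_realpow)
    also have "real (m - 1) = real N - real n" using m(3,5) by (metis of_nat_diff)
    finally have "\<bar>poly (map_poly real_of_int G) \<zeta>\<bar> \<le> H powr (- (real N - real n))" .
    then show "\<exists>P. P \<noteq> 0 \<and> degree P \<le> n \<and> \<bar>poly (map_poly real_of_int P) \<zeta>\<bar> < \<epsilon> \<and>
      \<bar>poly (map_poly real_of_int P) \<zeta>\<bar> \<le> real_of_int (poly_height P) powr (- (real N - real n))"
      using G0 degG 1 unfolding H_def by blast
  qed
qed

subsection \<open>Passing to the limit\<close>

lemma less_LimsupD: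
  fixes f :: "'a \<Rightarrow> 'b :: complete_linorder"
  assumes "y < Limsup F f"
  shows "\<exists>\<^sub>F x in F. y < f x"
proof (rule ccontr)
  assume "\<not> (\<exists>\<^sub>F x in F. y < f x)"
  then have "Limsup F f \<le> y" by (intro Limsup_bounded) (simp add: not_frequently not_less)
  then show False using assms by simp
qed

lemma frequently_le_imp_le_Limsup:
  fixes f :: "'a \<Rightarrow> 'b :: complete_linorder"
  assumes "\<exists>\<^sub>F x in F. y \<le> f x"
  shows "y \<le> Limsup F f"
proof (rule ccontr)
  assume "\<not> y \<le> Limsup F f"
  then have "\<forall>\<^sub>F x in F. f x < y" by (intro Limsup_lessD) simp
  then show False using assms by (simp add: frequently_def not_le)
qed

text \<open>Transfers infinitely many good indices along a map tending to infinity; this is how one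
  limsup is compared with another.\<close>

lemma frequently_compose_filterlim:
  assumes "\<exists>\<^sub>F x in F. P x" "filterlim f G F" "\<forall>\<^sub>F x in F. P x \<longrightarrow> Q (f x)"
  shows "\<exists>\<^sub>F x in G. Q x"
proof (rule ccontr)
  assume "\<not> (\<exists>\<^sub>F x in G. Q x)"
  then have "\<forall>\<^sub>F x in G. \<not> Q x" by (simp add: not_frequently)
  then have "\<forall>\<^sub>F x in F. \<not> Q (f x)" using assms(2) by (rule eventually_compose_filterlim)
  then have "\<forall>\<^sub>F x in F. \<not> P x" using assms(3) by eventually_elim auto
  then show False using assms(1) by (simp add: frequently_def)
qed

lemma filterlim_at_top_real_bound:
  fixes f :: "nat \<Rightarrow> nat" and g :: "nat \<Rightarrow> real"
  assumes "filterlim g at_top sequentially" "\<And>k. g k \<le> real (f k)"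
  shows "filterlim f at_top sequentially"
proof -
  have "filterlim (\<lambda>k. real (f k)) at_top sequentially"
    by (rule filterlim_at_top_mono[OF assms(1)]) (simp add: assms(2))
  then show ?thesis by (simp add: filterlim_sequentially_iff_filterlim_real)
qed

text \<open>For finite w > 1 the bound follows by letting v tend to w from below. At w = 1 no v is
  available, but the bound is then 1. At infinity (v + 1)^2 / (4 v) is at least v / 4.\<close>

lemma going_up_bound_le:
  assumes w: "1 \<le> w" and l: "1 \<le> l"
    and le: "\<And>v. 1 < v \<Longrightarrow> ereal v < w \<Longrightarrow> ereal ((v + 1)\<^sup>2 / (4 * v)) \<le> l"
  shows "going_up_bound w \<le> l"
proof (cases w)
  case (real r)
  have r: "r \<ge> 1" using w real by (simp add: one_ereal_def)
  have eq: "going_up_bound w = ereal ((r + 1)\<^sup>2 / (4 * r))"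
    using r real by (simp add: going_up_bound_def one_ereal_def power2_eq_square)
  show ?thesis
  proof (cases "r = 1")
    case True
    then show ?thesis using l by (simp add: eq one_ereal_def)
  next
    case False
    then have r1: "r > 1" using r by simp
    show ?thesis unfolding eq
    proof (rule tendsto_upperbound)
      show "((\<lambda>v. ereal ((v + 1)\<^sup>2 / (4 * v))) \<longlongrightarrow> ereal ((r + 1)\<^sup>2 / (4 * r))) (at_left r)"
        using r1 by (intro tendsto_intros) auto
      have "\<forall>\<^sub>F v in at_left r. v \<in> {1<..<r}" using r1 by (rule eventually_at_left_real)
      then show "\<forall>\<^sub>F v in at_left r. ereal ((v + 1)\<^sup>2 / (4 * v)) \<le> l"
        by eventually_elim (use le real in auto)
    qed simp
  qed
next
  case PInf
  have "ereal B \<le> l" for B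
  proof -
    define v where "v = max 2 (4 * B)"
    have v: "v > 1" "B \<le> v / 4" by (auto simp: v_def)
    have "v / 4 \<le> (v + 1)\<^sup>2 / (4 * v)" using v by (simp add: field_simps power2_eq_square)
    then have "ereal B \<le> ereal ((v + 1)\<^sup>2 / (4 * v))" using v by simp
    also have "\<dots> \<le> l" using v PInf by (intro le) auto
    finally show ?thesis .
  qed
  then have "l = \<infinity>" by (metis ereal_top)
  then show ?thesis by simp
qed (use w in auto)

text \<open>For \<open>L\<close> > 2 the assumption yields L - 1 <= w, which is more than is
  required; smaller \<open>L\<close> are covered by 2 <= w + 2.\<close>

lemma le_add_2_of_dense:
  fixes l w :: ereal
  assumes w: "1 \<le> w" and le: "\<And>L t. 2 < L \<Longrightarrow> ereal L < l \<Longrightarrow> t < L - 1 \<Longrightarrow> ereal t \<le> w"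
  shows "l \<le> w + 2"
proof (rule dense_le)
  fix y assume y: "y < l"
  have w2: "2 \<le> w + 2" using w by (metis add.left_neutral add_right_mono order_trans zero_less_one_ereal less_imp_le)
  show "y \<le> w + 2"
  proof (cases y)
    case (real L)
    show ?thesis
    proof (cases "L > 2")
      case True
      have "ereal (L - 1) \<le> w"
        by (rule ereal_le_dense[of "L - 2"]) (use le[OF True] y real in auto)
      then have "ereal (L - 1) + 2 \<le> w + 2" by (rule add_right_mono)
      moreover have "ereal L \<le> ereal (L - 1) + 2" by simp
      ultimately show ?thesis using real by (metis order_trans)
    next
      case False
      then have "ereal L \<le> 2" by simp
      then show ?thesis using real w2 order_trans by blast
    qed
  qed (use y in auto)
qed

section \<open>The inequalities between approximation exponents\<close>

context
  fixes \<zeta> :: real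
  assumes tr: "\<not> algebraic \<zeta>"
begin

text \<open>The choice \<open>\<beta> = (v + 1) / 2\<close> maximises \<open>\<beta> (v + 1 - \<beta>) / v\<close>, the limit of
  \<open>N (w + k - N) / ((k - 1) w + N)\<close> for \<open>w = v k\<close> and \<open>N = \<beta> k\<close>.\<close>

lemma exp_lambda_asymp_ge:
  fixes v t :: real
  assumes v: "v > 1" and t: "t < (v + 1)\<^sup>2 / (4 * v)"
  defines "\<beta> \<equiv> (v + 1) / 2"
  shows "\<forall>\<^sub>F k in sequentially. \<forall>N. \<bar>real N - \<beta> * real k\<bar> \<le> \<beta> \<longrightarrow> ereal (v * real k) < exp_w k \<zeta> \<longrightarrow>
    ereal t \<le> ereal (real N) * exp_lambda N \<zeta>"
proof -
  have \<beta>: "\<beta> > 1" "v + 1 - \<beta> = \<beta>" using v by (auto simp: \<beta>_def field_simps)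
  \<comment> \<open>Since N is within \<open>\<beta>\<close> of \<open>\<beta>\<close> k, the
    factors N and w + k - N are both at least \<open>\<beta>\<close> k - \<open>\<beta>\<close>, and
    the summand N in the denominator is at most \<open>\<beta>\<close> k + \<open>\<beta>\<close>.
    The limit of this worst case is \<open>\<beta>\<close>^2 / v = (v + 1)^2 / (4 v).\<close>
  have "((\<lambda>k. (\<beta> * real k - \<beta>) * (\<beta> * real k - \<beta>) / ((real k - 1) * (v * real k) + \<beta> * real k + \<beta>))
    \<longlongrightarrow> \<beta> * \<beta> / v) sequentially"
    using v \<beta> by (real_asymp simp: field_simps)
  moreover have "t < \<beta> * \<beta> / v" using t v by (simp add: \<beta>_def power2_eq_square)
  ultimately have "\<forall>\<^sub>F k in sequentially.
    t < (\<beta> * real k - \<beta>) * (\<beta> * real k - \<beta>) / ((real k - 1) * (v * real k) + \<beta> * real k + \<beta>)"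
    by (rule order_tendstoD)
  moreover have "\<forall>\<^sub>F k in sequentially. (\<beta> - 1) * real k \<ge> \<beta>" using \<beta> by real_asymp
  moreover have "\<forall>\<^sub>F k::nat in sequentially. k \<ge> 2" by (rule eventually_ge_at_top)
  ultimately show ?thesis
  proof eventually_elim
    case (elim k)
    show ?case
    proof (intro allI impI)
      fix N assume N: "\<bar>real N - \<beta> * real k\<bar> \<le> \<beta>" and w: "ereal (v * real k) < exp_w k \<zeta>"
      have k: "real k \<ge> 2" using elim(3) by simp
      have Nl: "\<beta> * real k - \<beta> \<le> real N" and Nu: "real N \<le> \<beta> * real k + \<beta>" using N by linarith+
      have "\<beta> * real k - \<beta> \<ge> real k" using elim(2) by (simp add: algebra_simps)
      then have kN: "k \<le> N" using Nl by linarith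
      have "v * real k + real k - real N \<ge> (v + 1 - \<beta>) * real k - \<beta>" using Nu by (simp add: algebra_simps)
      then have num: "v * real k + real k - real N \<ge> \<beta> * real k - \<beta>" by (simp only: \<beta>(2))
      have pos: "\<beta> * real k - \<beta> > 0" using \<beta> k by simp
      have "ereal ((v * real k + real k - real N) / ((real k - 1) * (v * real k) + real N)) \<le> exp_lambda N \<zeta>"
        using num pos k kN by (intro exp_lambda_going_up[OF tr _ _ _ w]) auto
      then have "ereal (real N) * ereal ((v * real k + real k - real N) / ((real k - 1) * (v * real k) + real N))
        \<le> ereal (real N) * exp_lambda N \<zeta>" by (intro ereal_mult_left_mono) auto
      moreover have "t \<le> real N * ((v * real k + real k - real N) / ((real k - 1) * (v * real k) + real N))"
      proof -
        have "t \<le> (\<beta> * real k - \<beta>) * (\<beta> * real k - \<beta>) / ((real k - 1) * (v * real k) + \<beta> * real k + \<beta>)"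
          using elim(1) by simp
        also have "\<dots> \<le> (real N * (v * real k + real k - real N)) / ((real k - 1) * (v * real k) + real N)"
        proof (intro frac_le mult_mono)
          have "(real k - 1) * (v * real k) \<ge> 0" using k v by (intro mult_nonneg_nonneg) auto
          then show "0 < (real k - 1) * (v * real k) + real N" using Nl pos by linarith
          show "0 \<le> real N * (v * real k + real k - real N)" using num pos by (intro mult_nonneg_nonneg) auto
        qed (use Nl Nu num pos in auto)
        finally show ?thesis by simp
      qed
      ultimately show "ereal t \<le> ereal (real N) * exp_lambda N \<zeta>"
        by (metis ereal_less_eq(3) order_trans times_ereal.simps(1))
    qed
  qed
qed

text \<open>From N < n L follows 1/n < L/N < \<open>\<lambda>\<close>_N, so w_n is at least N - n,
  which is about (L - 1) n. The slack -1 in the lower bound on N allows for rounding.\<close>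

lemma exp_w_asymp_ge:
  fixes L t :: real
  assumes L: "L > 2" and t: "t < L - 1"
  shows "\<forall>\<^sub>F n in sequentially. \<forall>N. (real n - 1) * L - 1 \<le> real N \<longrightarrow> real N < real n * L \<longrightarrow>
    ereal L < ereal (real N) * exp_lambda N \<zeta> \<longrightarrow> ereal t \<le> exp_w n \<zeta> / ereal (real n)"
proof -
  have "((\<lambda>n. ((real n - 1) * L - 1 - real n) / real n) \<longlongrightarrow> L - 1) sequentially"
    by (real_asymp simp: field_simps)
  then have "\<forall>\<^sub>F n in sequentially. t < ((real n - 1) * L - 1 - real n) / real n"
    using t by (rule order_tendstoD)
  moreover have "\<forall>\<^sub>F n in sequentially. (L - 2) * real n \<ge> L" using L by real_asymp
  moreover have "\<forall>\<^sub>F n::nat in sequentially. n \<ge> 2" by (rule eventually_ge_at_top)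
  ultimately show ?thesis
  proof eventually_elim
    case (elim n)
    show ?case
    proof (intro allI impI)
      fix N assume N: "(real n - 1) * L - 1 \<le> real N" "real N < real n * L"
        and lam: "ereal L < ereal (real N) * exp_lambda N \<zeta>"
      have n: "real n \<ge> 2" using elim(3) by simp
      \<comment> \<open>This is where L > 2 enters: it yields 2 n <= N + 1 for large n.\<close>
      have "(real n - 1) * L \<ge> 2 * real n" using elim(2) by (simp add: algebra_simps)
      then have nN: "2 * real n \<le> real N + 1" using N by linarith
      then have N0: "real N > 0" using n by linarith
      have "1 / real n < L / real N" using N n N0 by (simp add: field_simps)
      moreover have "ereal (L / real N) < exp_lambda N \<zeta>"
        using lam N0 L by (cases "exp_lambda N \<zeta>") (auto simp: field_simps)
      ultimately have "ereal (1 / real n) < exp_lambda N \<zeta>"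
        by (meson less_ereal.simps(1) less_trans)
      then have "ereal (real N - real n) \<le> exp_w n \<zeta>"
        using nN elim(3) by (intro exp_w_ge_of_exp_lambda[OF tr]) linarith+
      then have "ereal (real N - real n) / ereal (real n) \<le> exp_w n \<zeta> / ereal (real n)"
        using n by (intro ereal_divide_right_mono) auto
      moreover have "t \<le> (real N - real n) / real n"
      proof -
        have "t \<le> ((real n - 1) * L - 1 - real n) / real n" using elim(1) by simp
        also have "\<dots> \<le> (real N - real n) / real n" using N n by (intro divide_right_mono) auto
        finally show ?thesis .
      qed
      ultimately show "ereal t \<le> exp_w n \<zeta> / ereal (real n)"
        using n by (metis ereal_less_eq(3) order_trans ereal_divide neq0_conv not_numeral_le_zero of_nat_0 of_nat_eq_0_iff)
    qed
  qed
qed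

lemma less_exp_w_div:
  assumes "n \<ge> 1"
  shows "ereal v < exp_w n \<zeta> / ereal (real n) \<longleftrightarrow> ereal (v * real n) < exp_w n \<zeta>"
  using assms by (subst ereal_less_divide_pos) (auto simp: mult.commute)

lemma exp_w_div_ge_1: "\<forall>\<^sub>F n in sequentially. 1 \<le> exp_w n \<zeta> / ereal (real n)"
  using eventually_ge_at_top[of 1]
  by eventually_elim (subst ereal_le_divide_pos, auto intro: exp_w_ge[OF tr])

lemma exp_lambda_mult_ge_1: "\<forall>\<^sub>F n in sequentially. 1 \<le> ereal (real n) * exp_lambda n \<zeta>"
  using eventually_ge_at_top[of 1]
proof eventually_elim
  case (elim n)
  have "1 = ereal (real n) * ereal (1 / real n)" using elim by (simp add: one_ereal_def)
  also have "\<dots> \<le> ereal (real n) * exp_lambda n \<zeta>"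
    using exp_lambda_ge_inverse[OF elim, of \<zeta>] by (intro ereal_mult_left_mono) auto
  finally show ?case .
qed

lemma limits_ge_1:
  "1 \<le> w_lower \<zeta>" "1 \<le> w_upper \<zeta>" "1 \<le> lambda_lower \<zeta>" "1 \<le> lambda_upper \<zeta>"
proof -
  show 1: "1 \<le> w_lower \<zeta>" unfolding w_lower_def by (rule Liminf_bounded[OF exp_w_div_ge_1])
  show 2: "1 \<le> lambda_lower \<zeta>" unfolding lambda_lower_def by (rule Liminf_bounded[OF exp_lambda_mult_ge_1])
  have "w_lower \<zeta> \<le> w_upper \<zeta>" unfolding w_lower_def w_upper_def by (intro Liminf_le_Limsup) simp
  then show "1 \<le> w_upper \<zeta>" using 1 by simp
  have "lambda_lower \<zeta> \<le> lambda_upper \<zeta>" unfolding lambda_lower_def lambda_upper_def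
    by (intro Liminf_le_Limsup) simp
  then show "1 \<le> lambda_upper \<zeta>" using 2 by simp
qed

lemma going_up_upper: "going_up_bound (w_upper \<zeta>) \<le> lambda_upper \<zeta>"
proof (rule going_up_bound_le[OF limits_ge_1(2,4)])
  fix v :: real assume v: "1 < v" "ereal v < w_upper \<zeta>"
  define \<beta> where "\<beta> = (v + 1) / 2"
  have \<beta>: "\<beta> > 1" using v by (simp add: \<beta>_def)
  \<comment> \<open>For the limsup every good k has to produce one good N, so N is a function of
    k.\<close>
  define \<phi> where "\<phi> = (\<lambda>k. nat \<lfloor>\<beta> * real k\<rfloor>)"
  have \<phi>: "\<bar>real (\<phi> k) - \<beta> * real k\<bar> \<le> 1" for k
  proof -
    have "\<beta> * real k \<ge> 0" using \<beta> by simp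
    then show ?thesis unfolding \<phi>_def by linarith
  qed
  have \<phi>lim: "filterlim \<phi> at_top sequentially"
  proof (rule filterlim_at_top_real_bound)
    show "filterlim (\<lambda>k. \<beta> * real k - 1) at_top sequentially" using \<beta> by real_asymp
    show "\<beta> * real k - 1 \<le> real (\<phi> k)" for k using \<phi>[of k] by linarith
  qed
  show "ereal ((v + 1)\<^sup>2 / (4 * v)) \<le> lambda_upper \<zeta>"
  proof (rule ereal_le_dense[of "(v + 1)\<^sup>2 / (4 * v) - 1"])
    fix t assume t: "t < (v + 1)\<^sup>2 / (4 * v)"
    have "\<exists>\<^sub>F k in sequentially. ereal v < exp_w k \<zeta> / ereal (real k)"
      using v(2) unfolding w_upper_def by (rule less_LimsupD)
    then have "\<exists>\<^sub>F N in sequentially. ereal t \<le> ereal (real N) * exp_lambda N \<zeta>"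
    proof (rule frequently_compose_filterlim[OF _ \<phi>lim])
      show "\<forall>\<^sub>F k in sequentially. ereal v < exp_w k \<zeta> / ereal (real k) \<longrightarrow>
        ereal t \<le> ereal (real (\<phi> k)) * exp_lambda (\<phi> k) \<zeta>"
        using exp_lambda_asymp_ge[OF v(1) t] eventually_ge_at_top[of 1]
      proof eventually_elim
        case (elim k)
        have "\<bar>real (\<phi> k) - \<beta> * real k\<bar> \<le> \<beta>" using \<phi>[of k] \<beta> by linarith
        then show ?case using elim less_exp_w_div[of k v] by (auto simp: \<beta>_def)
      qed
    qed
    then show "ereal t \<le> lambda_upper \<zeta>" unfolding lambda_upper_def by (rule frequently_le_imp_le_Limsup)
  qed simp
qed

lemma going_up_lower: "going_up_bound (w_lower \<zeta>) \<le> lambda_lower \<zeta>"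
proof (rule going_up_bound_le[OF limits_ge_1(1,3)])
  fix v :: real assume v: "1 < v" "ereal v < w_lower \<zeta>"
  define \<beta> where "\<beta> = (v + 1) / 2"
  have \<beta>: "\<beta> > 1" using v by (simp add: \<beta>_def)
  \<comment> \<open>For the liminf every large N has to be served, so here k is a function of
    N.\<close>
  define \<phi> where "\<phi> = (\<lambda>N. nat \<lfloor>real N / \<beta>\<rfloor>)"
  have \<phi>: "\<bar>real N / \<beta> - real (\<phi> N)\<bar> \<le> 1" for N
  proof -
    have "real N / \<beta> \<ge> 0" using \<beta> by simp
    then show ?thesis unfolding \<phi>_def by linarith
  qed
  have \<phi>lim: "filterlim \<phi> at_top sequentially"
  proof (rule filterlim_at_top_real_bound)
    show "filterlim (\<lambda>N. real N / \<beta> - 1) at_top sequentially" using \<beta> by real_asymp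
    show "real N / \<beta> - 1 \<le> real (\<phi> N)" for N using \<phi>[of N] by linarith
  qed
  have \<phi>\<beta>: "\<bar>real N - \<beta> * real (\<phi> N)\<bar> \<le> \<beta>" for N
  proof -
    have "real N - \<beta> * real (\<phi> N) = \<beta> * (real N / \<beta> - real (\<phi> N))" using \<beta> by (simp add: field_simps)
    also have "\<bar>\<dots>\<bar> = \<beta> * \<bar>real N / \<beta> - real (\<phi> N)\<bar>" using \<beta> by (simp add: abs_mult)
    also have "\<dots> \<le> \<beta> * 1" using \<phi>[of N] \<beta> by (intro mult_left_mono) auto
    finally show ?thesis by simp
  qed
  show "ereal ((v + 1)\<^sup>2 / (4 * v)) \<le> lambda_lower \<zeta>"
  proof (rule ereal_le_dense[of "(v + 1)\<^sup>2 / (4 * v) - 1"])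
    fix t assume t: "t < (v + 1)\<^sup>2 / (4 * v)"
    have "\<forall>\<^sub>F k in sequentially. ereal v < exp_w k \<zeta> / ereal (real k)"
      using v(2) unfolding w_lower_def by (rule less_LiminfD)
    then have "\<forall>\<^sub>F k in sequentially. \<forall>N. \<bar>real N - \<beta> * real k\<bar> \<le> \<beta> \<longrightarrow>
      ereal t \<le> ereal (real N) * exp_lambda N \<zeta>"
      using exp_lambda_asymp_ge[OF v(1) t] eventually_ge_at_top[of 1]
    proof eventually_elim
      case (elim k)
      then show ?case using less_exp_w_div[of k v] by (auto simp: \<beta>_def)
    qed
    then have "\<forall>\<^sub>F N' in sequentially. \<forall>N. \<bar>real N - \<beta> * real (\<phi> N')\<bar> \<le> \<beta> \<longrightarrow>
      ereal t \<le> ereal (real N) * exp_lambda N \<zeta>"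
      using \<phi>lim by (rule eventually_compose_filterlim)
    then have "\<forall>\<^sub>F N in sequentially. ereal t \<le> ereal (real N) * exp_lambda N \<zeta>"
      by eventually_elim (use \<phi>\<beta> in blast)
    then show "ereal t \<le> lambda_lower \<zeta>" unfolding lambda_lower_def by (rule Liminf_bounded)
  qed simp
qed

lemma lambda_upper_le: "lambda_upper \<zeta> \<le> w_upper \<zeta> + 2"
proof (rule le_add_2_of_dense[OF limits_ge_1(2)])
  fix L t :: real assume L: "2 < L" "ereal L < lambda_upper \<zeta>" and t: "t < L - 1"
  \<comment> \<open>The least integer n above N / L, that is, the least n with 1/n < L/N for N >
    0.\<close>
  define \<phi> where "\<phi> = (\<lambda>N. nat \<lfloor>real N / L\<rfloor> + 1)"
  have \<phi>: "real N / L < real (\<phi> N)" "real (\<phi> N) - 1 \<le> real N / L" for N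
  proof -
    have "real N / L \<ge> 0" using L by simp
    then show "real N / L < real (\<phi> N)" "real (\<phi> N) - 1 \<le> real N / L" unfolding \<phi>_def by linarith+
  qed
  have \<phi>lim: "filterlim \<phi> at_top sequentially"
  proof (rule filterlim_at_top_real_bound)
    show "filterlim (\<lambda>N. real N / L) at_top sequentially" using L by real_asymp
  qed (use \<phi> less_imp_le in blast)
  have "\<exists>\<^sub>F N in sequentially. ereal L < ereal (real N) * exp_lambda N \<zeta>"
    using L(2) unfolding lambda_upper_def by (rule less_LimsupD)
  then have "\<exists>\<^sub>F n in sequentially. ereal t \<le> exp_w n \<zeta> / ereal (real n)"
  proof (rule frequently_compose_filterlim[OF _ \<phi>lim])
    show "\<forall>\<^sub>F N in sequentially. ereal L < ereal (real N) * exp_lambda N \<zeta> \<longrightarrow>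
      ereal t \<le> exp_w (\<phi> N) \<zeta> / ereal (real (\<phi> N))"
      using eventually_compose_filterlim[OF exp_w_asymp_ge[OF L(1) t] \<phi>lim]
    proof eventually_elim
      case (elim N)
      have "real N < real (\<phi> N) * L" "(real (\<phi> N) - 1) * L \<le> real N"
        using \<phi>[of N] L by (auto simp: field_simps)
      then have "(real (\<phi> N) - 1) * L - 1 \<le> real N" "real N < real (\<phi> N) * L" by linarith+
      then show ?case using elim by blast
    qed
  qed
  then show "ereal t \<le> w_upper \<zeta>" unfolding w_upper_def by (rule frequently_le_imp_le_Limsup)
qed

lemma lambda_lower_le: "lambda_lower \<zeta> \<le> w_lower \<zeta> + 2"
proof (rule le_add_2_of_dense[OF limits_ge_1(1)])
  fix L t :: real assume L: "2 < L" "ereal L < lambda_lower \<zeta>" and t: "t < L - 1"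
  \<comment> \<open>Now N depends on n; the factor n - 1 keeps N strictly below n L.\<close>
  define \<phi> where "\<phi> = (\<lambda>n. nat \<lfloor>(real n - 1) * L\<rfloor>)"
  have \<phi>lim: "filterlim \<phi> at_top sequentially"
  proof (rule filterlim_at_top_real_bound)
    show "filterlim (\<lambda>n. (real n - 1) * L - 1) at_top sequentially" using L by real_asymp
    show "(real n - 1) * L - 1 \<le> real (\<phi> n)" for n unfolding \<phi>_def by linarith
  qed
  have "\<forall>\<^sub>F N in sequentially. ereal L < ereal (real N) * exp_lambda N \<zeta>"
    using L(2) unfolding lambda_lower_def by (rule less_LiminfD)
  from eventually_compose_filterlim[OF this \<phi>lim] exp_w_asymp_ge[OF L(1) t] eventually_ge_at_top[of 1]
  have "\<forall>\<^sub>F n in sequentially. ereal t \<le> exp_w n \<zeta> / ereal (real n)"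
  proof eventually_elim
    case (elim n)
    have "(real n - 1) * L \<ge> 0" using elim(3) L by simp
    then have "(real n - 1) * L - 1 \<le> real (\<phi> n)" "real (\<phi> n) \<le> (real n - 1) * L"
      unfolding \<phi>_def by linarith+
    moreover have "(real n - 1) * L < real n * L" using L by (simp add: algebra_simps)
    ultimately show ?case using elim by auto
  qed
  then show "ereal t \<le> w_lower \<zeta>" unfolding w_lower_def by (rule Liminf_bounded)
qed

end

subsection \<open>The logarithmic exponents\<close>

lemma ln_ereal_ereal: "r > 0 \<Longrightarrow> ln_ereal (ereal r) = ereal (ln r)"
  by (simp add: ln_ereal_def)

lemma ln_ereal_mono: "x \<le> y \<Longrightarrow> ln_ereal x \<le> ln_ereal y"
  by (cases x; cases y) (auto simp: ln_ereal_def)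

lemma less_ln_ereal_iff: "ereal u < ln_ereal x \<longleftrightarrow> ereal (exp u) < x"
proof (cases x)
  case (real r)
  show ?thesis
  proof (cases "r > 0")
    case True
    then have "u < ln r \<longleftrightarrow> exp u < r" by (metis exp_less_cancel_iff exp_ln)
    then show ?thesis using True real by (simp add: ln_ereal_ereal)
  next
    case False
    then have "\<not> exp u < r" using exp_gt_zero[of u] by linarith
    then show ?thesis using False real by (simp add: ln_ereal_def)
  qed
qed (auto simp: ln_ereal_def)

lemma less_ln_ereal_div_iff:
  assumes "n \<ge> 2"
  shows "ereal t < ln_ereal x / ereal (ln (real n)) \<longleftrightarrow> ereal (real n powr t) < x"
proof -
  have "ln (real n) > 0" using assms by simp
  then have "ereal t < ln_ereal x / ereal (ln (real n)) \<longleftrightarrow> ereal (ln (real n) * t) < ln_ereal x"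
    by (subst ereal_less_divide_pos) auto
  also have "\<dots> \<longleftrightarrow> ereal (real n powr t) < x"
    using assms by (simp add: less_ln_ereal_iff powr_def mult.commute)
  finally show ?thesis .
qed

lemma ln_ereal_div_ge:
  assumes "n \<ge> 2" "r > 0" "ereal r \<le> x" "t * ln (real n) \<le> ln r"
  shows "ereal t \<le> ln_ereal x / ereal (ln (real n))"
proof (subst ereal_le_divide_pos)
  have "ereal (ln (real n)) * ereal t \<le> ereal (ln r)" using assms(4) by (simp add: mult.commute)
  also have "\<dots> \<le> ln_ereal x" using ln_ereal_mono[OF assms(3)] assms(2) by (simp add: ln_ereal_ereal)
  finally show "ereal (ln (real n)) * ereal t \<le> ln_ereal x" .
qed (use assms in auto)

section \<open>The relation between sigma and tau\<close>

context
  fixes \<zeta> :: real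
  assumes tr: "\<not> algebraic \<zeta>"
begin

lemma exp_tau_ge_1: "1 \<le> exp_tau \<zeta>"
proof -
  have "\<forall>\<^sub>F n in sequentially. 1 \<le> ln_ereal (exp_w n \<zeta>) / ereal (ln (real n))"
    using eventually_ge_at_top[of 2]
  proof eventually_elim
    case (elim n)
    then show ?case unfolding one_ereal_def
      using exp_w_ge[OF tr, of n] by (intro ln_ereal_div_ge[of n "real n"]) auto
  qed
  then have "1 \<le> liminf (\<lambda>n. ln_ereal (exp_w n \<zeta>) / ereal (ln (real n)))" by (rule Liminf_bounded)
  also have "\<dots> \<le> exp_tau \<zeta>" unfolding exp_tau_def by (rule Liminf_le_Limsup) simp
  finally show ?thesis .
qed

lemma exp_sigma_ge_minus_1: "- 1 \<le> exp_sigma \<zeta>"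
proof -
  have "\<forall>\<^sub>F n in sequentially. ereal (- 1) \<le> ln_ereal (exp_lambda n \<zeta>) / ereal (ln (real n))"
    using eventually_ge_at_top[of 2]
  proof eventually_elim
    case (elim n)
    then show ?case
      using exp_lambda_ge_inverse[of n \<zeta>] by (intro ln_ereal_div_ge[of n "1 / real n"]) (auto simp: ln_div)
  qed
  then have "ereal (- 1) \<le> liminf (\<lambda>n. ln_ereal (exp_lambda n \<zeta>) / ereal (ln (real n)))" by (rule Liminf_bounded)
  also have "\<dots> \<le> exp_sigma \<zeta>" unfolding exp_sigma_def by (rule Liminf_le_Limsup) simp
  finally show ?thesis by (simp add: one_ereal_def)
qed

text \<open>Let w = k^t and let N be about w / 2. The numerator w + k - N is at least w / 2 and the
  denominator at most k w, so \<open>\<lambda>\<close>_N is at least 1 / (2 k), while k is about (2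
  N)^(1/t).\<close>

lemma exp_sigma_ge:
  assumes t: "1 < t" "ereal t < exp_tau \<zeta>"
  shows "ereal (- 1 / t) \<le> exp_sigma \<zeta>"
proof (rule ereal_le_dense[of "- 1 / t - 1"])
  fix s assume s: "s < - 1 / t"
  define \<phi> where "\<phi> = (\<lambda>k. nat \<lfloor>real k powr t / 2\<rfloor>)"
  have \<phi>: "real k powr t / 2 - 1 \<le> real (\<phi> k)" "real (\<phi> k) \<le> real k powr t / 2" for k
  proof -
    have "real k powr t / 2 \<ge> 0" by simp
    then show "real k powr t / 2 - 1 \<le> real (\<phi> k)" "real (\<phi> k) \<le> real k powr t / 2"
      unfolding \<phi>_def by linarith+
  qed
  have \<phi>lim: "filterlim \<phi> at_top sequentially"
  proof (rule filterlim_at_top_real_bound)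
    show "filterlim (\<lambda>k. real k powr t / 2 - 1) at_top sequentially" using t by real_asymp
  qed (rule \<phi>)
  have "\<exists>\<^sub>F k in sequentially. ereal t < ln_ereal (exp_w k \<zeta>) / ereal (ln (real k))"
    using t(2) unfolding exp_tau_def by (rule less_LimsupD)
  then have "\<exists>\<^sub>F N in sequentially. ereal s \<le> ln_ereal (exp_lambda N \<zeta>) / ereal (ln (real N))"
  proof (rule frequently_compose_filterlim[OF _ \<phi>lim])
    have "((\<lambda>k. - ln (2 * real k) / ln (real k powr t / 2 - 1)) \<longlongrightarrow> - 1 / t) sequentially"
      using t by (real_asymp simp: field_simps)
    then have "\<forall>\<^sub>F k in sequentially. s < - ln (2 * real k) / ln (real k powr t / 2 - 1)"
      using s by (rule order_tendstoD)
    moreover have "\<forall>\<^sub>F k in sequentially. real k powr t / 2 - 1 \<ge> real k" using t by real_asymp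
    moreover have "\<forall>\<^sub>F k::nat in sequentially. k \<ge> 2" by (rule eventually_ge_at_top)
    ultimately show "\<forall>\<^sub>F k in sequentially. ereal t < ln_ereal (exp_w k \<zeta>) / ereal (ln (real k)) \<longrightarrow>
      ereal s \<le> ln_ereal (exp_lambda (\<phi> k) \<zeta>) / ereal (ln (real (\<phi> k)))"
    proof eventually_elim
      case (elim k)
      define w where "w = real k powr t"
      define N where "N = \<phi> k"
      have k: "real k \<ge> 2" using elim(3) by simp
      have N: "w / 2 - 1 \<le> real N" "real N \<le> w / 2" using \<phi>[of k] by (auto simp: N_def w_def)
      have kN: "k \<le> N" using N(1) elim(2) by (simp add: w_def)
      have w: "w > 0" using k by (simp add: w_def)
      show ?case
      proof
        assume "ereal t < ln_ereal (exp_w k \<zeta>) / ereal (ln (real k))"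
        then have "ereal w < exp_w k \<zeta>" unfolding w_def less_ln_ereal_div_iff[OF elim(3)] .
        then have "ereal ((w + real k - real N) / ((real k - 1) * w + real N)) \<le> exp_lambda N \<zeta>"
          using kN k N w by (intro exp_lambda_going_up[OF tr]) auto
        moreover have "1 / (2 * real k) \<le> (w + real k - real N) / ((real k - 1) * w + real N)"
        proof -
          have "1 / (2 * real k) = (w / 2) / (real k * w)" using w by simp
          also have "\<dots> \<le> (w + real k - real N) / ((real k - 1) * w + real N)"
          proof (rule frac_le)
            have "(real k - 1) * w \<ge> 0" using k w by (intro mult_nonneg_nonneg) auto
            then show "0 < (real k - 1) * w + real N" using kN k by linarith
            show "(real k - 1) * w + real N \<le> real k * w" using N w by (simp add: algebra_simps)
          qed (use N w k in auto)
          finally show ?thesis .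
        qed
        ultimately have lam: "ereal (1 / (2 * real k)) \<le> exp_lambda N \<zeta>"
          by (meson ereal_less_eq(3) order_trans)
        have "s * ln (real N) \<le> ln (1 / (2 * real k))"
        proof -
          have l0: "ln (w / 2 - 1) > 0" using elim(2) k by (simp add: w_def)
          have "ln (w / 2 - 1) \<le> ln (real N)" using N elim(2) k by (simp add: w_def)
          \<comment> \<open>Since s is negative, the lower bound on ln N becomes an upper bound on s
            ln N.\<close>
          moreover have "s < 0" using s t by (smt (verit) divide_neg_pos)
          ultimately have "s * ln (real N) \<le> s * ln (w / 2 - 1)" by (simp add: mult_left_mono_neg)
          also have "\<dots> \<le> - ln (2 * real k)" using elim(1) l0 unfolding w_def
            by (subst (asm) pos_less_divide_eq) auto
          also have "\<dots> = ln (1 / (2 * real k))" using k by (simp add: ln_div)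
          finally show ?thesis .
        qed
        then have "ereal s \<le> ln_ereal (exp_lambda N \<zeta>) / ereal (ln (real N))"
          using kN k lam by (intro ln_ereal_div_ge[of N "1 / (2 * real k)"]) auto
        then show "ereal s \<le> ln_ereal (exp_lambda (\<phi> k) \<zeta>) / ereal (ln (real (\<phi> k)))"
          by (simp add: N_def)
      qed
    qed
  qed
  then show "ereal s \<le> exp_sigma \<zeta>" unfolding exp_sigma_def by (rule frequently_le_imp_le_Limsup)
qed simp

text \<open>Finiteness of \<open>\<lambda>\<close>_1 enters here: \<open>\<lambda>\<close>_n does
  not increase with n, so ln \<open>\<lambda>\<close>_n stays bounded above and is negligible
  against ln n.\<close>

lemma exp_sigma_nonpos:
  assumes "exp_lambda 1 \<zeta> \<noteq> \<infinity>"
  shows "exp_sigma \<zeta> \<le> 0"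
proof -
  have "ereal 1 \<le> exp_lambda 1 \<zeta>" using exp_lambda_ge_inverse[of 1 \<zeta>] by simp
  then obtain r where r: "exp_lambda 1 \<zeta> = ereal r" "r \<ge> 1"
    using assms by (cases "exp_lambda 1 \<zeta>") auto
  have "\<forall>\<^sub>F n in sequentially. ln_ereal (exp_lambda n \<zeta>) / ereal (ln (real n)) \<le> ereal (ln r / ln (real n))"
    using eventually_ge_at_top[of 2]
  proof eventually_elim
    case (elim n)
    have "ln_ereal (exp_lambda n \<zeta>) \<le> ereal (ln r)"
      using ln_ereal_mono[OF exp_lambda_antimono[of 1 n \<zeta>]] elim r by (simp add: ln_ereal_ereal)
    then have "ln_ereal (exp_lambda n \<zeta>) / ereal (ln (real n)) \<le> ereal (ln r) / ereal (ln (real n))"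
      using elim by (intro ereal_divide_right_mono) auto
    then show ?case using elim by simp
  qed
  then have "exp_sigma \<zeta> \<le> limsup (\<lambda>n. ereal (ln r / ln (real n)))"
    unfolding exp_sigma_def by (rule Limsup_mono)
  also have "(\<lambda>n. ln r / ln (real n)) \<longlonglongrightarrow> 0" by real_asymp
  then have "limsup (\<lambda>n. ereal (ln r / ln (real n))) = ereal 0"
    by (intro lim_imp_Limsup) auto
  finally show ?thesis unfolding zero_ereal_def .
qed

text \<open>Take n just above N^s. Then 1/n < N^(-s) < \<open>\<lambda>\<close>_N, so w_n is at
  least N - n, which has logarithmic order 1/s in n because s < 1.\<close>

lemma exp_tau_ge:
  assumes s: "0 < s" "s < 1" and less: "ereal (- s) < exp_sigma \<zeta>"
  shows "ereal (1 / s) \<le> exp_tau \<zeta>"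
proof (rule ereal_le_dense[of 0])
  show "0 < 1 / s" using s by simp
  fix u assume u: "0 < u" "u < 1 / s"
  define \<phi> where "\<phi> = (\<lambda>N. nat \<lfloor>real N powr s\<rfloor> + 1)"
  have \<phi>: "real N powr s < real (\<phi> N)" "real (\<phi> N) \<le> real N powr s + 1" for N
  proof -
    have "real N powr s \<ge> 0" by simp
    then show "real N powr s < real (\<phi> N)" "real (\<phi> N) \<le> real N powr s + 1"
      unfolding \<phi>_def by linarith+
  qed
  have \<phi>lim: "filterlim \<phi> at_top sequentially"
  proof (rule filterlim_at_top_real_bound)
    show "filterlim (\<lambda>N. real N powr s) at_top sequentially" using s by real_asymp
  qed (use \<phi> less_imp_le in blast)
  have "\<exists>\<^sub>F N in sequentially. ereal (- s) < ln_ereal (exp_lambda N \<zeta>) / ereal (ln (real N))"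
    using less unfolding exp_sigma_def by (rule less_LimsupD)
  then have "\<exists>\<^sub>F n in sequentially. ereal u \<le> ln_ereal (exp_w n \<zeta>) / ereal (ln (real n))"
  proof (rule frequently_compose_filterlim[OF _ \<phi>lim])
    have "((\<lambda>N. ln (real N - real N powr s - 1) / ln (real N powr s + 1)) \<longlongrightarrow> 1 / s) sequentially"
      using s by (real_asymp simp: field_simps)
    then have "\<forall>\<^sub>F N in sequentially. u < ln (real N - real N powr s - 1) / ln (real N powr s + 1)"
      using u by (intro order_tendstoD)
    moreover have "\<forall>\<^sub>F N in sequentially. 2 * (real N powr s + 1) \<le> real N" using s by real_asymp
    moreover have "\<forall>\<^sub>F N in sequentially. real N powr s > 1" using s by real_asymp
    moreover have "\<forall>\<^sub>F N::nat in sequentially. N \<ge> 2" by (rule eventually_ge_at_top)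
    ultimately show "\<forall>\<^sub>F N in sequentially. ereal (- s) < ln_ereal (exp_lambda N \<zeta>) / ereal (ln (real N)) \<longrightarrow>
      ereal u \<le> ln_ereal (exp_w (\<phi> N) \<zeta>) / ereal (ln (real (\<phi> N)))"
    proof eventually_elim
      case (elim N)
      define n where "n = \<phi> N"
      define x where "x = real N powr s"
      have n: "x < real n" "real n \<le> x + 1" using \<phi>[of N] by (auto simp: n_def x_def)
      have x: "x > 1" "2 * (x + 1) \<le> real N" using elim(2,3) by (auto simp: x_def)
      have "real (2 * n) \<le> real (N + 1)" using n x by simp
      then have n2: "n \<ge> 2" "2 * n \<le> N + 1" using n x by (linarith, simp only: of_nat_le_iff)
      show ?case
      proof
        assume "ereal (- s) < ln_ereal (exp_lambda N \<zeta>) / ereal (ln (real N))"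
        then have "ereal (real N powr (- s)) < exp_lambda N \<zeta>" unfolding less_ln_ereal_div_iff[OF elim(4)] .
        moreover have "1 / real n < real N powr (- s)"
          using n x by (simp add: powr_minus_divide x_def[symmetric] frac_less2)
        ultimately have "ereal (1 / real n) < exp_lambda N \<zeta>"
          by (meson less_ereal.simps(1) less_trans)
        then have w: "ereal (real N - real n) \<le> exp_w n \<zeta>"
          using n2 by (intro exp_w_ge_of_exp_lambda[OF tr]) auto
        have "u * ln (real n) \<le> u * ln (x + 1)" using u n x by (intro mult_left_mono) auto
        also have "\<dots> \<le> ln (real N - x - 1)"
          using elim(1) x by (simp add: x_def[symmetric] pos_less_divide_eq)
        also have "\<dots> \<le> ln (real N - real n)" using n x by simp
        finally have "ereal u \<le> ln_ereal (exp_w n \<zeta>) / ereal (ln (real n))"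
          using n2 w n x by (intro ln_ereal_div_ge[of n "real N - real n"]) auto
        then show "ereal u \<le> ln_ereal (exp_w (\<phi> N) \<zeta>) / ereal (ln (real (\<phi> N)))"
          by (simp add: n_def)
      qed
    qed
  qed
  then show "ereal u \<le> exp_tau \<zeta>" unfolding exp_tau_def by (rule frequently_le_imp_le_Limsup)
qed

text \<open>The two implications between large w_k and large \<open>\<lambda>\<close>_N are inverse
  to each other under t = 1/s. The boundary case tau = 1 rests on the Dirichlet bound sigma >= -1,
  and tau = infinity on the sign bound sigma <= 0.\<close>

lemma exp_sigma_eq:
  assumes fin: "exp_lambda 1 \<zeta> \<noteq> \<infinity>"
  shows "exp_sigma \<zeta> = - (1 / exp_tau \<zeta>)"
proof (cases "exp_tau \<zeta>")
  case (real r)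
  have r: "r \<ge> 1" using exp_tau_ge_1 real by (simp add: one_ereal_def)
  have eq: "- (1 / exp_tau \<zeta>) = ereal (- 1 / r)" using r real by (simp add: one_ereal_def)
  show ?thesis unfolding eq
  proof (rule antisym)
    show "ereal (- 1 / r) \<le> exp_sigma \<zeta>"
    proof (cases "r = 1")
      case True
      then show ?thesis using exp_sigma_ge_minus_1 by (simp add: one_ereal_def)
    next
      case False
      then have r1: "r > 1" using r by simp
      show ?thesis
      proof (rule ereal_le_dense[of "- 1"])
        show "- 1 < - 1 / r" using r1 by simp
        fix l assume l: "- 1 < l" "l < - 1 / r"
        have l0: "l < 0" using l r1 by (smt (verit) divide_neg_pos)
        have "1 < - 1 / l" "- 1 / l < r" using l l0 r1 by (auto simp: field_simps)
        then show "ereal l \<le> exp_sigma \<zeta>" using exp_sigma_ge[of "- 1 / l"] real by simp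
      qed
    qed
    show "exp_sigma \<zeta> \<le> ereal (- 1 / r)"
    proof (rule ccontr)
      assume "\<not> exp_sigma \<zeta> \<le> ereal (- 1 / r)"
      then obtain l where l: "- 1 / r < l" "ereal l < exp_sigma \<zeta>"
        using ereal_dense2[of "ereal (- 1 / r)" "exp_sigma \<zeta>"] by (auto simp: not_le)
      \<comment> \<open>Placing l strictly between -1 and 0 makes -l an admissible exponent s for
        the lower bound on tau.\<close>
      have "ereal l < 0" using l(2) exp_sigma_nonpos[OF fin] by (rule less_le_trans)
      then have l0: "l < 0" by simp
      have "- 1 \<le> - 1 / r" using r by simp
      then have l1: "- 1 < l" using l(1) by linarith
      have "1 / (- l) \<le> r" using exp_tau_ge[of "- l"] l l0 l1 real by simp
      then show False using l(1) l0 r by (simp add: field_simps)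
    qed
  qed
next
  case PInf
  have "exp_sigma \<zeta> = 0"
  proof (rule antisym)
    show "exp_sigma \<zeta> \<le> 0" by (rule exp_sigma_nonpos[OF fin])
    have "ereal 0 \<le> exp_sigma \<zeta>"
    proof (rule ereal_le_dense[of "- 1"])
      fix l :: real assume l: "- 1 < l" "l < 0"
      then have "1 < - 1 / l" by (simp add: field_simps)
      then show "ereal l \<le> exp_sigma \<zeta>" using exp_sigma_ge[of "- 1 / l"] PInf by simp
    qed simp
    then show "0 \<le> exp_sigma \<zeta>" unfolding zero_ereal_def .
  qed
  then show ?thesis using PInf by simp
qed (use exp_tau_ge_1 in auto)

end

theorem theorem2p4:
  fixes \<zeta> :: real
  assumes "\<not> algebraic \<zeta>"
  shows "going_up_bound (w_upper \<zeta>) \<le> lambda_upper \<zeta> \<and> lambda_upper \<zeta> \<le> w_upper \<zeta> + 2 \<and>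
    going_up_bound (w_lower \<zeta>) \<le> lambda_lower \<zeta> \<and> lambda_lower \<zeta> \<le> w_lower \<zeta> + 2 \<and>
    (exp_lambda 1 \<zeta> \<noteq> \<infinity> \<longrightarrow> exp_sigma \<zeta> = - (1 / exp_tau \<zeta>))"
  using going_up_upper[OF assms] lambda_upper_le[OF assms] going_up_lower[OF assms]
    lambda_lower_le[OF assms] exp_sigma_eq[OF assms] by blast

end
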